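(* Let $X$ be a convex-transitive real Banach space. Then $L_{s}^{\infty}(X)$ is convex-transitive, and for every $1\leq p<\infty$ the Bochner space $L^{p}(X)=L^{p}([0,1],X)$ is convex-transitive.
   Context: All Banach spaces are real. For a Banach space $E$, let $\mathbf{B}_E$ be its closed unit ball, $\mathbf{S}_E$ its unit sphere, and $\mathcal{G}_E$ the group of isometric automorphisms (surjective linear isometries) $T\colon E\to E$; for $x\in E$ write $\mathcal{G}_E(x)=\{T(x): T\in\mathcal{G}_E\}$. The space $E$ is called convex-transitive if $\overline{\mathrm{conv}}(\mathcal{G}_E(x))=\mathbf{B}_E$ (norm-closed convex hull) for every $x\in\mathbf{S}_E$. Let $\Sigma$ be the $\sigma$-algebra of Lebesgue measurable subsets of $[0,1]$ and let $[0,1]$ carry Lebesgue measure. For $1\le p\le\infty$, $L^p(X)$ is the Lebesgue–Bochner space of (a.e. classes of) strongly measurable maps $f\colon[0,1]\to X$ with norm $\|f\|_{L^p(X)}^p=\int_0^1\|f(t)\|_X^p\,dt<\infty$ if $p<\infty$, and $\|f\|_{L^\infty(X)}=\operatorname{ess\,sup}_{t\in[0,1]}\|f(t)\|_X<\infty$ if $p=\infty$. The space $L_s^\infty(X)$ is the closed linear span in $L^\infty(X)$ of the functions $\chi_A x$ with $A\in\Sigma$ and $x\in X$, with the norm of $L^\infty(X)$. *)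

theory Defs
  imports "HOL-Probability.Essential_Supremum"
begin

text \<open>
  The Lebesgue--Bochner spaces form a family of subspaces of one vector space of a.e. classes, each
  with its own norm.  A normed space is therefore given by a subspace \<open>V\<close> of the
  vector space formed by a type, and a function \<open>N\<close> whose restriction to \<open>V\<close> is the norm.
  A Banach space that is a type of class \<open>banach\<close> is the pair \<open>UNIV\<close>, \<open>norm\<close>.
\<close>

definition isometric_automorphism ::
  "'v::real_vector set \<Rightarrow> ('v \<Rightarrow> real) \<Rightarrow> ('v \<Rightarrow> 'v) \<Rightarrow> bool" where
  "isometric_automorphism V N T \<longleftrightarrow>
     bij_betw T V V \<and>
     (\<forall>x\<in>V. \<forall>y\<in>V. T (x + y) = T x + T y) \<and>
     (\<forall>c. \<forall>x\<in>V. T (c *\<^sub>R x) = c *\<^sub>R T x) \<and>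
     (\<forall>x\<in>V. N (T x) = N x)"

definition isometry_orbit :: "'v::real_vector set \<Rightarrow> ('v \<Rightarrow> real) \<Rightarrow> 'v \<Rightarrow> 'v set" where
  "isometry_orbit V N x = {T x | T. isometric_automorphism V N T}"

definition norm_closure :: "'v::real_vector set \<Rightarrow> ('v \<Rightarrow> real) \<Rightarrow> 'v set \<Rightarrow> 'v set" where
  "norm_closure V N S = {x \<in> V. \<forall>e>0. \<exists>y\<in>S. N (y - x) < e}"

definition convex_transitive :: "'v::real_vector set \<Rightarrow> ('v \<Rightarrow> real) \<Rightarrow> bool" where
  "convex_transitive V N \<longleftrightarrow>
     (\<forall>x\<in>V. N x = 1 \<longrightarrow>
        norm_closure V N (convex hull (isometry_orbit V N x)) = {y \<in> V. N y \<le> 1})"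

lemma norm_closure_UNIV: "norm_closure UNIV norm S = closure S"
  by (auto simp: norm_closure_def closure_approachable dist_norm)

abbreviation unit_leb :: "real measure" where
  "unit_leb \<equiv> lebesgue_on {0..1}"

definition strongly_measurable :: "'b measure \<Rightarrow> ('b \<Rightarrow> 'a::real_normed_vector) \<Rightarrow> bool" where
  "strongly_measurable M f \<longleftrightarrow>
     (\<exists>s. (\<forall>i. simple_function M (s i)) \<and> (AE t in M. (\<lambda>i::nat. s i t) \<longlonglongrightarrow> f t))"

lemma strongly_measurable_simple: "simple_function M f \<Longrightarrow> strongly_measurable M f"
  unfolding strongly_measurable_def by (intro exI[of _ "\<lambda>_. f"]) auto

lemma strongly_measurable_add:
  assumes "strongly_measurable M f" "strongly_measurable M g"
  shows "strongly_measurable M (\<lambda>t. f t + g t)"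
proof -
  from assms obtain s u where
    *: "\<And>i. simple_function M (s i)" "\<And>i. simple_function M (u i)" and
    lim: "AE t in M. (\<lambda>i::nat. s i t) \<longlonglongrightarrow> f t" "AE t in M. (\<lambda>i::nat. u i t) \<longlonglongrightarrow> g t"
    unfolding strongly_measurable_def by blast
  from lim have "AE t in M. (\<lambda>i. s i t + u i t) \<longlonglongrightarrow> f t + g t"
    by eventually_elim (rule tendsto_add)
  moreover have "simple_function M (\<lambda>t. s i t + u i t)" for i
    using * by (rule simple_function_add)
  ultimately show ?thesis unfolding strongly_measurable_def
    by (intro exI[of _ "\<lambda>i t. s i t + u i t"]) simp
qed

lemma strongly_measurable_scaleR:
  assumes "strongly_measurable M f"
  shows "strongly_measurable M (\<lambda>t. c *\<^sub>R f t)"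
proof -
  from assms obtain s where
    *: "\<And>i. simple_function M (s i)" and lim: "AE t in M. (\<lambda>i::nat. s i t) \<longlonglongrightarrow> f t"
    unfolding strongly_measurable_def by blast
  from lim have "AE t in M. (\<lambda>i. c *\<^sub>R s i t) \<longlonglongrightarrow> c *\<^sub>R f t"
    by eventually_elim (intro tendsto_intros)
  moreover have "simple_function M (\<lambda>t. c *\<^sub>R s i t)" for i
    using * by (rule simple_function_compose1)
  ultimately show ?thesis unfolding strongly_measurable_def
    by (intro exI[of _ "\<lambda>i t. c *\<^sub>R s i t"]) simp
qed

lemma strongly_measurable_uminus:
  "strongly_measurable M f \<Longrightarrow> strongly_measurable M (\<lambda>t. - f t)"
  using strongly_measurable_scaleR[of M f "-1"] by simp

lemma complete_measure_unit_leb: "complete_measure unit_leb"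
proof
  fix A B :: "real set" assume "B \<subseteq> A" "A \<in> null_sets unit_leb"
  then have "A \<in> null_sets lebesgue" "B \<subseteq> {0..1}"
    by (auto simp: null_sets_restrict_space)
  with \<open>B \<subseteq> A\<close> have "B \<in> null_sets unit_leb"
    by (simp add: null_sets_restrict_space completion.complete2[of B A])
  then show "B \<in> sets unit_leb" by (rule null_setsD2)
qed

lemma borel_measurable_unit_leb_AE:
  fixes f g :: "real \<Rightarrow> 'b::topological_space"
  assumes f: "f \<in> borel_measurable unit_leb" and ae: "AE t in unit_leb. f t = g t"
  shows "g \<in> borel_measurable unit_leb"
proof (rule measurableI)
  fix A :: "'b set" assume "A \<in> sets borel"
  with f have "f -` A \<inter> space unit_leb \<in> sets unit_leb" by (rule measurable_sets)
  moreover have "AE t in unit_leb. t \<in> f -` A \<inter> space unit_leb \<longleftrightarrow> t \<in> g -` A \<inter> space unit_leb"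
    using ae by eventually_elim simp
  ultimately show "g -` A \<inter> space unit_leb \<in> sets unit_leb"
    using complete_measure.in_sets_AE[OF complete_measure_unit_leb] by blast
qed simp

lemma strongly_measurable_norm:
  fixes f :: "real \<Rightarrow> 'a::real_normed_vector"
  assumes "strongly_measurable unit_leb f"
  shows "(\<lambda>t. norm (f t)) \<in> borel_measurable unit_leb"
proof -
  from assms obtain s where
    s: "\<And>i. simple_function unit_leb (s i)" "AE t in unit_leb. (\<lambda>i::nat. s i t) \<longlonglongrightarrow> f t"
    unfolding strongly_measurable_def by blast
  have [measurable]: "(\<lambda>t. norm (s i t)) \<in> borel_measurable unit_leb" for i
    by (rule borel_measurable_simple_function[OF simple_function_compose1[OF s(1)]])
  have "(\<lambda>t. lim (\<lambda>i. norm (s i t))) \<in> borel_measurable unit_leb"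
    by measurable
  moreover have "AE t in unit_leb. lim (\<lambda>i. norm (s i t)) = norm (f t)"
    using s(2) by eventually_elim (intro limI tendsto_norm)
  ultimately show ?thesis by (rule borel_measurable_unit_leb_AE)
qed

text \<open>
  The relation is reflexive exactly on the strongly measurable functions, so the (partial) quotient
  \<open>L0\<close> consists of the a.e. classes of strongly measurable functions on the unit interval;
  values outside the interval are irrelevant.
\<close>

definition ae_rel ::
  "(real \<Rightarrow> 'a::real_normed_vector) \<Rightarrow> (real \<Rightarrow> 'a) \<Rightarrow> bool" where
  "ae_rel f g \<longleftrightarrow>
     strongly_measurable unit_leb f \<and> strongly_measurable unit_leb g \<and>
     (AE t in unit_leb. f t = g t)"

lemma ae_rel_trans:
  assumes "ae_rel f g" "ae_rel g h"
  shows "ae_rel f h"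
proof -
  from assms have "AE t in unit_leb. f t = g t" "AE t in unit_leb. g t = h t"
    by (simp_all add: ae_rel_def)
  then have "AE t in unit_leb. f t = h t"
    by eventually_elim simp
  with assms show ?thesis by (simp add: ae_rel_def)
qed

quotient_type (overloaded) 'a L0 = "real \<Rightarrow> 'a::real_normed_vector" / partial: ae_rel
proof (rule part_equivpI)
  show "\<exists>f. ae_rel f f"
    by (intro exI[of _ "\<lambda>_. 0"]) (simp add: ae_rel_def strongly_measurable_simple)
  show "symp ae_rel"
    by (auto simp: symp_def ae_rel_def eq_commute)
  show "transp ae_rel"
    by (rule transpI) (rule ae_rel_trans)
qed

instantiation L0 :: (real_normed_vector) real_vector
begin

lift_definition zero_L0 :: "'a L0" is "\<lambda>_. 0"
  by (simp add: ae_rel_def strongly_measurable_simple)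

lift_definition plus_L0 :: "'a L0 \<Rightarrow> 'a L0 \<Rightarrow> 'a L0" is "\<lambda>f g t. f t + g t"
proof -
  fix f f' g g' :: "real \<Rightarrow> 'a" assume fg: "ae_rel f f'" "ae_rel g g'"
  then have "AE t in unit_leb. f t = f' t" "AE t in unit_leb. g t = g' t"
    by (simp_all add: ae_rel_def)
  then have "AE t in unit_leb. f t + g t = f' t + g' t"
    by eventually_elim simp
  with fg show "ae_rel (\<lambda>t. f t + g t) (\<lambda>t. f' t + g' t)"
    by (simp add: ae_rel_def strongly_measurable_add)
qed

lift_definition uminus_L0 :: "'a L0 \<Rightarrow> 'a L0" is "\<lambda>f t. - f t"
proof -
  fix f f' :: "real \<Rightarrow> 'a" assume f: "ae_rel f f'"
  then have "AE t in unit_leb. f t = f' t"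
    by (simp add: ae_rel_def)
  then have "AE t in unit_leb. - f t = - f' t"
    by eventually_elim simp
  with f show "ae_rel (\<lambda>t. - f t) (\<lambda>t. - f' t)"
    by (simp add: ae_rel_def strongly_measurable_uminus)
qed

definition minus_L0 :: "'a L0 \<Rightarrow> 'a L0 \<Rightarrow> 'a L0" where
  "minus_L0 F G = F + - G"

lift_definition scaleR_L0 :: "real \<Rightarrow> 'a L0 \<Rightarrow> 'a L0" is "\<lambda>c f t. c *\<^sub>R f t"
proof -
  fix c :: real and f f' :: "real \<Rightarrow> 'a" assume f: "ae_rel f f'"
  then have "AE t in unit_leb. f t = f' t"
    by (simp add: ae_rel_def)
  then have "AE t in unit_leb. c *\<^sub>R f t = c *\<^sub>R f' t"
    by eventually_elim simp
  with f show "ae_rel (\<lambda>t. c *\<^sub>R f t) (\<lambda>t. c *\<^sub>R f' t)"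
    by (simp add: ae_rel_def strongly_measurable_scaleR)
qed

instance
proof
  fix F G H :: "'a L0" and c d :: real
  note sm = strongly_measurable_add strongly_measurable_scaleR strongly_measurable_uminus
    strongly_measurable_simple
  show "F + G + H = F + (G + H)"
    by transfer (simp add: ae_rel_def sm add.assoc)
  show "F + G = G + F"
    by transfer (simp add: ae_rel_def sm add.commute)
  show "0 + F = F"
    by transfer (simp add: ae_rel_def sm)
  show "- F + F = 0"
    by transfer (simp add: ae_rel_def sm)
  show "F - G = F + - G"
    by (fact minus_L0_def)
  show "c *\<^sub>R (F + G) = c *\<^sub>R F + c *\<^sub>R G"
    by transfer (simp add: ae_rel_def sm scaleR_add_right)
  show "(c + d) *\<^sub>R F = c *\<^sub>R F + d *\<^sub>R F"
    by transfer (simp add: ae_rel_def sm scaleR_add_left)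
  show "c *\<^sub>R d *\<^sub>R F = (c * d) *\<^sub>R F"
    by transfer (simp add: ae_rel_def sm)
  show "1 *\<^sub>R F = F"
    by transfer (simp add: ae_rel_def sm)
qed

end

lift_definition Lp_nn_integral :: "real \<Rightarrow> 'a::real_normed_vector L0 \<Rightarrow> ennreal"
  is "\<lambda>p f. \<integral>\<^sup>+ t. ennreal (norm (f t) powr p) \<partial>unit_leb"
proof (rule nn_integral_cong_AE)
  fix p :: real and f f' :: "real \<Rightarrow> 'a" assume "ae_rel f f'"
  then have "AE t in unit_leb. f t = f' t"
    by (simp add: ae_rel_def)
  then show "AE t in unit_leb. ennreal (norm (f t) powr p) = ennreal (norm (f' t) powr p)"
    by eventually_elim simp
qed

definition Lp_space :: "real \<Rightarrow> 'a::real_normed_vector L0 set" where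
  "Lp_space p = {F. Lp_nn_integral p F < \<infinity>}"

definition Lp_norm :: "real \<Rightarrow> 'a::real_normed_vector L0 \<Rightarrow> real" where
  "Lp_norm p F = enn2real (Lp_nn_integral p F) powr (1 / p)"

text \<open>
  The library's \<open>esssup\<close> is infinite on functions that are not Borel measurable; this does
  not happen here, by \<open>strongly_measurable_norm\<close>.
\<close>

lift_definition Linf_esssup :: "'a::real_normed_vector L0 \<Rightarrow> ereal"
  is "\<lambda>f. esssup unit_leb (\<lambda>t. ereal (norm (f t)))"
proof (rule esssup_AE_cong)
  fix f f' :: "real \<Rightarrow> 'a" assume f: "ae_rel f f'"
  then have "AE t in unit_leb. f t = f' t"
    by (simp add: ae_rel_def)
  then show "AE t in unit_leb. ereal (norm (f t)) = ereal (norm (f' t))"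
    by eventually_elim simp
  from f show "(\<lambda>t. ereal (norm (f t))) \<in> borel_measurable unit_leb"
    "(\<lambda>t. ereal (norm (f' t))) \<in> borel_measurable unit_leb"
    by (simp_all add: ae_rel_def strongly_measurable_norm borel_measurable_ereal)
qed

definition Linf_space :: "'a::real_normed_vector L0 set" where
  "Linf_space = {F. Linf_esssup F < \<infinity>}"

definition Linf_norm :: "'a::real_normed_vector L0 \<Rightarrow> real" where
  "Linf_norm F = real_of_ereal (Linf_esssup F)"

text \<open>
  The class of \<open>\<chi>\<^sub>A x\<close>; the branch \<open>0\<close> only makes the function total and
  is not used below.
\<close>

lift_definition indicator_L0 :: "real set \<Rightarrow> 'a \<Rightarrow> 'a::real_normed_vector L0"
  is "\<lambda>A x t. if A \<in> sets unit_leb then indicat_real A t *\<^sub>R x else 0"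
proof -
  fix A :: "real set" and x :: 'a
  have "simple_function unit_leb (\<lambda>t. indicat_real A t *\<^sub>R x)" if "A \<in> sets unit_leb"
    using simple_function_indicator[OF that] by (rule simple_function_compose1)
  then have "simple_function unit_leb (\<lambda>t. if A \<in> sets unit_leb then indicat_real A t *\<^sub>R x else 0)"
    by (cases "A \<in> sets unit_leb") (simp_all only: if_True if_False simple_function_const)
  then show "ae_rel (\<lambda>t. if A \<in> sets unit_leb then indicat_real A t *\<^sub>R x else 0)
      (\<lambda>t. if A \<in> sets unit_leb then indicat_real A t *\<^sub>R x else 0)"
    by (simp add: ae_rel_def strongly_measurable_simple)
qed

definition Linf_simple_space :: "'a::real_normed_vector L0 set" where
  "Linf_simple_space =
     norm_closure Linf_space Linf_norm
       (span {indicator_L0 A x | A x. A \<in> sets unit_leb})"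

end

theory Submission
  imports Defs "HOL-Probability.Weak_Convergence"
begin

text \<open>
  Fix \<open>F\<close> of norm one and let \<open>K\<close> be the closed convex hull of its orbit.  Then \<open>K\<close> contains \<open>F\<close>, is
  closed and convex, and is invariant under every isometric automorphism.  Since simple functions are
  dense and \<open>K\<close> depends continuously on \<open>F\<close>, it is enough to show that \<open>K\<close> contains a given simple \<open>G\<close>
  of norm one when \<open>F\<close> is simple (\<open>convex_transitiveI\<close>).

  Isometric automorphisms come from two sources.  An isometry \<open>T\<close> of \<open>X\<close> can be applied to the values
  of a function on a measurable set \<open>B\<close> and nothing be done elsewhere.  If an element of \<open>K\<close> has the
  constant value \<open>u\<close> of norm one on \<open>B\<close>, then \<open>u\<close> may thus be replaced by \<open>T u\<close>, hence, as \<open>K\<close> is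
  closed and convex, by anything in the closed convex hull of the orbit of \<open>u\<close>; convex-transitivity of
  \<open>X\<close> says that this is the whole unit ball.  Treating the finitely many pieces on which two simple
  functions are constant one after the other shows: once \<open>K\<close> contains one simple function whose values
  all have norm one, it contains every simple function bounded by one (\<open>unimodular_in_orbit_hull\<close>).

  The second source, composition with nonsingular transformations of the interval, serves to find such
  a unimodular function in \<open>K\<close>.  The transformations are distribution functions and their inverses
  (\<open>rearrangement_exists\<close>).  For \<open>p < \<infinity>\<close>, composition is weighted to keep the norm, and the
  transformation that carries the density \<open>\<parallel>F\<parallel>\<^sup>p\<close> to Lebesgue measure turns a nowhere vanishing \<open>F\<close>
  into \<open>F / \<parallel>F\<parallel>\<close> (\<open>isometric_to_unimodular\<close>).  The same can be done to \<open>G\<close>, and the isometry undone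
  at the end, so both may be taken to be unimodular.

  For \<open>p = \<infinity>\<close> there are no weights.  Here \<open>F\<close> has a value \<open>x\<close> of norm one on a set of positive
  measure, and composition can stretch that set over all but the first third, or all but the last third,
  of the interval.  The mean of the two results lies in \<open>K\<close>, and at almost every point one of the two is
  \<open>x\<close>; so the distance to the constant function \<open>x\<close> is halved, and \<open>x\<close> is still attained on the middle third.
  Iteration puts the constant function \<open>x\<close> into \<open>K\<close> (\<open>constant_in_orbit_hull\<close>).
\<close>

section \<open>Orbit hulls in seminormed spaces\<close>

text \<open>
  The norms at hand are given on a subspace of a vector space.  The arguments about closed convex hulls
  use only the seminorm laws there.
\<close>

locale seminormed_subspace =
  fixes V :: "'v::real_vector set" and N :: "'v \<Rightarrow> real"
  assumes subspace: "subspace V"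
    and triangle: "\<lbrakk>x \<in> V; y \<in> V\<rbrakk> \<Longrightarrow> N (x + y) \<le> N x + N y"
    and homogeneous: "x \<in> V \<Longrightarrow> N (c *\<^sub>R x) = \<bar>c\<bar> * N x"
begin

lemma add_mem: "\<lbrakk>x \<in> V; y \<in> V\<rbrakk> \<Longrightarrow> x + y \<in> V"
  and diff_mem: "\<lbrakk>x \<in> V; y \<in> V\<rbrakk> \<Longrightarrow> x - y \<in> V"
  and scale_mem: "x \<in> V \<Longrightarrow> c *\<^sub>R x \<in> V"
  using subspace by (auto simp: subspace_add subspace_diff subspace_scale)

lemma N_zero: "N 0 = 0"
  using homogeneous[of 0 0] subspace by (simp add: subspace_0)

lemma N_minus: "x \<in> V \<Longrightarrow> N (- x) = N x"
  using homogeneous[of x "-1"] by simp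

lemma N_minus_commute: "\<lbrakk>x \<in> V; y \<in> V\<rbrakk> \<Longrightarrow> N (x - y) = N (y - x)"
  using N_minus[of "x - y"] by (simp add: diff_mem)

lemma N_nonneg: "x \<in> V \<Longrightarrow> 0 \<le> N x"
  using triangle[of x "- x"] N_minus[of x] N_zero scale_mem[of x "-1"] by simp

lemma triangle_diff:
  assumes "x \<in> V" "y \<in> V" "z \<in> V"
  shows "N (x - z) \<le> N (x - y) + N (y - z)"
  using triangle[of "x - y" "y - z"] assms by (simp add: diff_mem)

lemma N_le_diff:
  assumes "x \<in> V" "y \<in> V"
  shows "N x \<le> N (x - y) + N y"
  using triangle[of "x - y" y] assms by (simp add: diff_mem)

lemma convex_ball: "convex {x \<in> V. N x \<le> r}"
proof (rule convexI)
  fix x y u v assume *: "x \<in> {x \<in> V. N x \<le> r}" "y \<in> {x \<in> V. N x \<le> r}"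
    "0 \<le> (u::real)" "0 \<le> v" "u + v = 1"
  then have "N (u *\<^sub>R x + v *\<^sub>R y) \<le> u * N x + v * N y"
    using triangle[of "u *\<^sub>R x" "v *\<^sub>R y"] by (simp add: scale_mem homogeneous)
  also have "\<dots> \<le> u * r + v * r"
    using * by (intro add_mono mult_left_mono) auto
  also have "\<dots> = r"
    using * by (simp flip: distrib_right)
  finally show "u *\<^sub>R x + v *\<^sub>R y \<in> {x \<in> V. N x \<le> r}"
    using * by (simp add: add_mem scale_mem)
qed

lemma norm_closure_subset: "norm_closure V N S \<subseteq> V"
  by (auto simp: norm_closure_def)

lemma subset_norm_closure: "S \<subseteq> V \<Longrightarrow> S \<subseteq> norm_closure V N S"
  using N_zero by (force simp: norm_closure_def)

lemma norm_closure_closed: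
  assumes "S \<subseteq> V"
  shows "norm_closure V N (norm_closure V N S) \<subseteq> norm_closure V N S"
proof
  fix x assume x: "x \<in> norm_closure V N (norm_closure V N S)"
  then have xV: "x \<in> V" by (simp add: norm_closure_def)
  have "\<exists>z\<in>S. N (z - x) < e" if "e > 0" for e
  proof -
    have "e / 2 > 0" using that by simp
    with x obtain y where y: "y \<in> norm_closure V N S" "N (y - x) < e / 2"
      unfolding norm_closure_def by blast
    moreover from \<open>e / 2 > 0\<close> y obtain z where z: "z \<in> S" "N (z - y) < e / 2"
      unfolding norm_closure_def by blast
    ultimately have "N (z - x) < e"
      using triangle_diff[of z y x] xV assms by (auto simp: norm_closure_def)
    with z show ?thesis by blast
  qed
  with xV show "x \<in> norm_closure V N S" by (simp add: norm_closure_def)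
qed

lemma convex_norm_closure:
  assumes "convex S" "S \<subseteq> V"
  shows "convex (norm_closure V N S)"
proof (rule convexI)
  fix x y u v assume *: "x \<in> norm_closure V N S" "y \<in> norm_closure V N S"
    "0 \<le> (u::real)" "0 \<le> v" "u + v = 1"
  then have V: "x \<in> V" "y \<in> V" by (auto simp: norm_closure_def)
  have "\<exists>z\<in>S. N (z - (u *\<^sub>R x + v *\<^sub>R y)) < e" if "e > 0" for e
  proof -
    from that * obtain x' y' where
      xy: "x' \<in> S" "N (x' - x) < e" "y' \<in> S" "N (y' - y) < e"
      unfolding norm_closure_def by blast
    let ?z = "u *\<^sub>R x' + v *\<^sub>R y'"
    have V': "x' - x \<in> V" "y' - y \<in> V" using xy V assms(2) by (auto intro: diff_mem)
    then have "u *\<^sub>R (x' - x) + v *\<^sub>R (y' - y) \<in> {w \<in> V. N w \<le> max (N (x' - x)) (N (y' - y))}"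
      by (intro convexD[OF convex_ball _ _ *(3-5)]) auto
    then have "N (?z - (u *\<^sub>R x + v *\<^sub>R y)) \<le> max (N (x' - x)) (N (y' - y))"
      by (simp add: algebra_simps)
    also have "\<dots> < e" using xy by simp
    finally show ?thesis
      using convexD[OF assms(1) xy(1,3) *(3-5)] by blast
  qed
  with V show "u *\<^sub>R x + v *\<^sub>R y \<in> norm_closure V N S"
    by (simp add: norm_closure_def add_mem scale_mem)
qed

lemma isometric_automorphismD:
  assumes "isometric_automorphism V N T"
  shows "x \<in> V \<Longrightarrow> T x \<in> V" "\<lbrakk>x \<in> V; y \<in> V\<rbrakk> \<Longrightarrow> T (x + y) = T x + T y"
    "x \<in> V \<Longrightarrow> T (c *\<^sub>R x) = c *\<^sub>R T x" "x \<in> V \<Longrightarrow> N (T x) = N x"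
    "\<lbrakk>x \<in> V; y \<in> V\<rbrakk> \<Longrightarrow> T (x - y) = T x - T y"
proof -
  show *: "x \<in> V \<Longrightarrow> T x \<in> V" "\<lbrakk>x \<in> V; y \<in> V\<rbrakk> \<Longrightarrow> T (x + y) = T x + T y"
    "x \<in> V \<Longrightarrow> T (c *\<^sub>R x) = c *\<^sub>R T x" "x \<in> V \<Longrightarrow> N (T x) = N x" for x y c
    using assms by (auto simp: isometric_automorphism_def bij_betw_apply)
  assume "x \<in> V" "y \<in> V"
  then show "T (x - y) = T x - T y"
    using *(2)[of x "-1 *\<^sub>R y"] *(3)[of y "-1"] scale_mem[of y "-1"] by simp
qed

lemma isometric_automorphism_compose:
  assumes "isometric_automorphism V N T" "isometric_automorphism V N S"
  shows "isometric_automorphism V N (T \<circ> S)"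
  using assms bij_betw_trans[of S V V T V] isometric_automorphismD[OF assms(1)]
    isometric_automorphismD[OF assms(2)]
  by (auto simp: isometric_automorphism_def)

lemma isometric_automorphism_inverse:
  assumes T: "isometric_automorphism V N T"
  shows "isometric_automorphism V N (inv_into V T)"
proof -
  have bij: "bij_betw T V V" using T by (simp add: isometric_automorphism_def)
  note inv = bij_betw_inv_into[OF bij]
  have mem: "x \<in> V \<Longrightarrow> inv_into V T x \<in> V" and TI: "x \<in> V \<Longrightarrow> T (inv_into V T x) = x"
    and IT: "x \<in> V \<Longrightarrow> inv_into V T (T x) = x" for x
    using bij inv by (auto simp: bij_betw_apply bij_betw_inv_into_left bij_betw_inv_into_right)
  note D = isometric_automorphismD[OF T]
  show ?thesis unfolding isometric_automorphism_def
  proof (intro conjI ballI allI)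
    fix x y c assume V: "x \<in> V" "y \<in> V"
    have "inv_into V T (x + y) = inv_into V T (T (inv_into V T x + inv_into V T y))"
      using V by (simp add: D mem TI)
    then show "inv_into V T (x + y) = inv_into V T x + inv_into V T y"
      using V by (simp add: IT mem add_mem)
  next
    fix x c assume V: "x \<in> V"
    have "inv_into V T (c *\<^sub>R x) = inv_into V T (T (c *\<^sub>R inv_into V T x))"
      using V by (simp add: D mem TI)
    then show "inv_into V T (c *\<^sub>R x) = c *\<^sub>R inv_into V T x"
      using V by (simp add: IT mem scale_mem)
    show "N (inv_into V T x) = N x"
      using D(4)[OF mem[OF V]] V by (simp add: TI)
  qed (rule inv)
qed

lemma isometric_automorphism_scale:
  assumes "\<bar>c\<bar> = 1" shows "isometric_automorphism V N (\<lambda>x. c *\<^sub>R x)"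
proof -
  have "c * c = 1" using assms by (simp add: abs_if split: if_splits)
  then have "bij_betw (\<lambda>x. c *\<^sub>R x) V V"
    by (intro bij_betwI[where g = "\<lambda>x. c *\<^sub>R x"]) (auto simp: scale_mem)
  then show ?thesis
    using assms by (auto simp: isometric_automorphism_def homogeneous scaleR_add_right)
qed

definition orbit_hull :: "'v \<Rightarrow> 'v set" where
  "orbit_hull F = norm_closure V N (convex hull (isometry_orbit V N F))"

context
  fixes F assumes F: "F \<in> V"
begin

lemma isometry_orbit_subset: "isometry_orbit V N F \<subseteq> {x \<in> V. N x \<le> N F}"
  using F isometric_automorphismD by (fastforce simp: isometry_orbit_def)

lemma hull_orbit_subset: "convex hull (isometry_orbit V N F) \<subseteq> {x \<in> V. N x \<le> N F}"
  using isometry_orbit_subset convex_ball by (rule hull_minimal)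

lemma orbit_hull_subset: "orbit_hull F \<subseteq> {x \<in> V. N x \<le> N F}"
proof
  fix x assume x: "x \<in> orbit_hull F"
  then have xV: "x \<in> V" by (simp add: orbit_hull_def norm_closure_def)
  have "N x \<le> N F + e" if "e > 0" for e
  proof -
    from x that obtain y where y: "y \<in> convex hull (isometry_orbit V N F)" "N (y - x) < e"
      by (auto simp: orbit_hull_def norm_closure_def)
    then have "y \<in> V" "N y \<le> N F" using hull_orbit_subset by auto
    then show ?thesis
      using y N_le_diff[of x y] N_minus_commute[of x y] xV by auto
  qed
  then show "x \<in> {x \<in> V. N x \<le> N F}" using xV by (auto intro: field_le_epsilon)
qed

lemma convex_orbit_hull: "convex (orbit_hull F)"
  unfolding orbit_hull_def
  by (rule convex_norm_closure[OF convex_convex_hull], rule order_trans[OF hull_orbit_subset]) simp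

lemma orbit_hull_closed:
  assumes "G \<in> V" "\<And>e. e > 0 \<Longrightarrow> \<exists>H\<in>orbit_hull F. N (H - G) < e"
  shows "G \<in> orbit_hull F"
proof -
  have "G \<in> norm_closure V N (orbit_hull F)"
    using assms by (simp add: norm_closure_def)
  then show ?thesis
    unfolding orbit_hull_def
    using norm_closure_closed[OF order_trans[OF hull_orbit_subset]] by auto
qed

lemma hull_orbit_subset_orbit_hull: "convex hull (isometry_orbit V N F) \<subseteq> orbit_hull F"
  unfolding orbit_hull_def
  by (rule subset_norm_closure, rule order_trans[OF hull_orbit_subset]) simp

lemma self_in_orbit_hull: "F \<in> orbit_hull F"
proof -
  have "isometric_automorphism V N (\<lambda>x. 1 *\<^sub>R x)"
    by (rule isometric_automorphism_scale) simp
  then have "F \<in> isometry_orbit V N F"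
    by (force simp: isometry_orbit_def)
  then show ?thesis
    using hull_orbit_subset_orbit_hull by (blast intro: hull_inc)
qed

text \<open>
  An isometry permutes the orbit, so by linearity it maps the convex hull of the orbit into itself, and by
  continuity also the closure.
\<close>

lemma orbit_hull_invariant:
  assumes T: "isometric_automorphism V N T" and G: "G \<in> orbit_hull F"
  shows "T G \<in> orbit_hull F"
proof -
  let ?O = "isometry_orbit V N F"
  note D = isometric_automorphismD[OF T]
  have "?O \<subseteq> {y \<in> V. T y \<in> convex hull ?O}"
  proof
    fix y assume y: "y \<in> ?O"
    then obtain S where S: "isometric_automorphism V N S" "y = S F"
      by (auto simp: isometry_orbit_def)
    then have "T y \<in> ?O"
      using isometric_automorphism_compose[OF T S(1)] unfolding isometry_orbit_def
      by (metis (mono_tags, lifting) comp_apply mem_Collect_eq)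
    then show "y \<in> {y \<in> V. T y \<in> convex hull ?O}"
      using y isometry_orbit_subset by (auto intro: hull_inc)
  qed
  moreover have "convex {y \<in> V. T y \<in> convex hull ?O}"
  proof (rule convexI)
    fix x y u v assume *: "x \<in> {y \<in> V. T y \<in> convex hull ?O}" "y \<in> {y \<in> V. T y \<in> convex hull ?O}"
      "0 \<le> (u::real)" "0 \<le> v" "u + v = 1"
    then have "u *\<^sub>R T x + v *\<^sub>R T y \<in> convex hull ?O"
      by (intro convexD[OF convex_convex_hull]) auto
    then show "u *\<^sub>R x + v *\<^sub>R y \<in> {y \<in> V. T y \<in> convex hull ?O}"
      using * by (simp add: D scale_mem add_mem)
  qed
  ultimately have hull: "convex hull ?O \<subseteq> {y \<in> V. T y \<in> convex hull ?O}"
    by (rule hull_minimal)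
  have GV: "G \<in> V" using G by (simp add: orbit_hull_def norm_closure_def)
  have "\<exists>z\<in>convex hull ?O. N (z - T G) < e" if "e > 0" for e
  proof -
    from G that obtain y where y: "y \<in> convex hull ?O" "N (y - G) < e"
      by (auto simp: orbit_hull_def norm_closure_def)
    then have "T y \<in> convex hull ?O" "y \<in> V" using hull by auto
    moreover have "N (T y - T G) = N (y - G)"
      using D(4)[of "y - G"] D(5)[of y G] GV \<open>y \<in> V\<close> by (simp add: diff_mem)
    ultimately show ?thesis using y(2) by (intro bexI[of _ "T y"]) simp_all
  qed
  then show ?thesis using GV by (simp add: orbit_hull_def norm_closure_def D)
qed

end

text \<open>
  Perturbing the generator of an orbit hull perturbs the hull uniformly, because an isometry moves
  the generator and its perturbation along with each other.
\<close>

lemma orbit_hull_perturb: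
  assumes V: "F \<in> V" "F' \<in> V" and G: "G \<in> orbit_hull F'" and F: "N (F' - F) < e"
  shows "\<exists>H\<in>orbit_hull F. N (H - G) < e"
proof -
  let ?P = "{x \<in> V. \<exists>H\<in>convex hull (isometry_orbit V N F). N (H - x) \<le> N (F' - F)}"
  have "isometry_orbit V N F' \<subseteq> ?P"
  proof
    fix y assume y: "y \<in> isometry_orbit V N F'"
    then obtain T where T: "isometric_automorphism V N T" "y = T F'"
      by (auto simp: isometry_orbit_def)
    note D = isometric_automorphismD[OF T(1)]
    have "N (T F - y) = N (F' - F)"
      using D(4)[of "F - F'"] D(5)[of F F'] V T by (simp add: diff_mem N_minus_commute)
    moreover have "T F \<in> convex hull (isometry_orbit V N F)"
      using T by (auto intro!: hull_inc simp: isometry_orbit_def)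
    ultimately show "y \<in> ?P" using T V D(1)[of F'] by force
  qed
  moreover have "convex ?P"
  proof (rule convexI)
    fix x y u v assume *: "x \<in> ?P" "y \<in> ?P" "0 \<le> (u::real)" "0 \<le> v" "u + v = 1"
    then obtain H H' where H: "H \<in> convex hull (isometry_orbit V N F)" "N (H - x) \<le> N (F' - F)"
      "H' \<in> convex hull (isometry_orbit V N F)" "N (H' - y) \<le> N (F' - F)" by auto
    then have HV: "H \<in> V" "H' \<in> V" using hull_orbit_subset[OF V(1)] by auto
    have "u *\<^sub>R (H - x) + v *\<^sub>R (H' - y) \<in> {x \<in> V. N x \<le> N (F' - F)}"
      using * H HV by (intro convexD[OF convex_ball]) (auto simp: diff_mem)
    then have "N ((u *\<^sub>R H + v *\<^sub>R H') - (u *\<^sub>R x + v *\<^sub>R y)) \<le> N (F' - F)"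
      by (simp add: algebra_simps)
    moreover have "u *\<^sub>R H + v *\<^sub>R H' \<in> convex hull (isometry_orbit V N F)"
      using H * by (intro convexD[OF convex_convex_hull]) auto
    ultimately show "u *\<^sub>R x + v *\<^sub>R y \<in> ?P"
      using * by (auto simp: add_mem scale_mem)
  qed
  ultimately have hull: "convex hull (isometry_orbit V N F') \<subseteq> ?P" by (rule hull_minimal)
  have GV: "G \<in> V" using G by (simp add: orbit_hull_def norm_closure_def)
  obtain y where y: "y \<in> convex hull (isometry_orbit V N F')" "N (y - G) < e - N (F' - F)"
    using G F unfolding orbit_hull_def norm_closure_def
    by (auto dest!: spec[of _ "e - N (F' - F)"])
  with hull obtain H where H: "H \<in> convex hull (isometry_orbit V N F)" "N (H - y) \<le> N (F' - F)"
    by auto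
  have "H \<in> V" "y \<in> V" using H y hull hull_orbit_subset[OF V(1)] by auto
  then have "N (H - G) < e"
    using triangle_diff[of H y G] GV y H by simp
  moreover have "H \<in> orbit_hull F"
    using H(1) hull_orbit_subset_orbit_hull[OF V(1)] by auto
  ultimately show ?thesis by blast
qed

text \<open>
  Only generators and targets of norm one in a dense cone \<open>D\<close> need be considered.  Dividing by the norm
  makes \<open>D\<close> dense in the sphere, the generator can be perturbed by the previous lemma, and the target
  because the hull is closed.  The hull is convex and contains the sphere, so it contains the ball:
  a vector inside the ball lies between two opposite vectors of the sphere.  A nonzero vector may have
  seminorm zero, and such a vector is approximated by \<open>0\<close>, the midpoint of \<open>F\<close> and \<open>-F\<close>.
\<close>

lemma convex_transitiveI:
  assumes D: "D \<subseteq> V" "\<And>x c. \<lbrakk>x \<in> D; c \<noteq> 0\<rbrakk> \<Longrightarrow> c *\<^sub>R x \<in> D"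
    and dense: "\<And>x e. \<lbrakk>x \<in> V; N x = 1; 0 < e\<rbrakk> \<Longrightarrow> \<exists>y\<in>D. N (y - x) < e"
    and trans: "\<And>F G. \<lbrakk>F \<in> D; G \<in> D; N F = 1; N G = 1\<rbrakk> \<Longrightarrow> G \<in> orbit_hull F"
  shows "convex_transitive V N"
proof -
  have dense1: "\<exists>y\<in>D. N y = 1 \<and> N (y - x) < e" if x: "x \<in> V" "N x = 1" and e: "0 < e" for x e
  proof -
    obtain y where y: "y \<in> D" "N (y - x) < min (e / 2) (1 / 2)"
      using dense[OF x, of "min (e/2) (1/2)"] e by auto
    have yV: "y \<in> V" using y D by auto
    have "\<bar>N y - 1\<bar> \<le> N (y - x)"
      using N_le_diff[of x y] N_le_diff[of y x] N_minus_commute[of x y] yV x by auto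
    then have Ny: "\<bar>N y - 1\<bar> < e / 2" "N y > 0" using y by auto
    let ?z = "(1 / N y) *\<^sub>R y"
    have z: "?z \<in> V" using yV by (rule scale_mem)
    have "?z - y = (1 / N y - 1) *\<^sub>R y" by (simp add: algebra_simps)
    then have "N (?z - y) = \<bar>1 / N y - 1\<bar> * N y" using yV by (simp add: homogeneous)
    also have "\<dots> = \<bar>(1 / N y - 1) * N y\<bar>" using Ny by (simp add: abs_mult)
    also have "(1 / N y - 1) * N y = 1 - N y" using Ny by (simp add: field_simps)
    finally have "N (?z - x) < e"
      using triangle_diff[OF z yV x(1)] Ny y by (simp add: abs_minus_commute)
    moreover have "N ?z = 1" using Ny yV by (simp add: homogeneous)
    moreover have "?z \<in> D" using Ny y D(2)[of y "1 / N y"] by simp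
    ultimately show ?thesis by blast
  qed
  have "orbit_hull F = {y \<in> V. N y \<le> 1}" if F: "F \<in> V" "N F = 1" for F
  proof
    show "orbit_hull F \<subseteq> {y \<in> V. N y \<le> 1}" using orbit_hull_subset[OF F(1)] F by simp
    have sphere: "G \<in> orbit_hull F" if G: "G \<in> V" "N G = 1" for G
    proof (rule orbit_hull_closed[OF F(1) G(1)])
      fix e :: real assume "e > 0"
      then obtain F' G' where *: "F' \<in> D" "N F' = 1" "N (F' - F) < e / 2"
        "G' \<in> D" "N G' = 1" "N (G' - G) < e / 2"
        using dense1[OF F, of "e/2"] dense1[OF G, of "e/2"] by auto
      then obtain H where H: "H \<in> orbit_hull F" "N (H - G') < e / 2"
        using orbit_hull_perturb[OF F(1) _ trans[of F' G']] D by blast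
      then have "N (H - G) < e"
        using triangle_diff[of H G' G] * G D(1) orbit_hull_subset[OF F(1)] by fastforce
      then show "\<exists>H\<in>orbit_hull F. N (H - G) < e" using H by blast
    qed
    show "{y \<in> V. N y \<le> 1} \<subseteq> orbit_hull F"
    proof
      fix G assume "G \<in> {y \<in> V. N y \<le> 1}"
      then have G: "G \<in> V" "N G \<le> 1" by auto
      show "G \<in> orbit_hull F"
      proof (cases "N G = 0")
        case True
        have "(1/2) *\<^sub>R F + (1/2) *\<^sub>R (- F) \<in> orbit_hull F"
          using F N_minus[of F] scale_mem[of F "-1"]
          by (intro convexD[OF convex_orbit_hull[OF F(1)]] sphere) auto
        then have "0 \<in> orbit_hull F" by simp
        then show ?thesis
          using True G N_minus[of G] by (intro orbit_hull_closed[OF F(1)]) force+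
      next
        case False
        then have N: "N G > 0" using N_nonneg[OF G(1)] by simp
        let ?y = "(1 / N G) *\<^sub>R G"
        have y: "?y \<in> V" "N ?y = 1" using G N by (auto simp: scale_mem homogeneous)
        have "((1 + N G) / 2) *\<^sub>R ?y + ((1 - N G) / 2) *\<^sub>R (- ?y) \<in> orbit_hull F"
          using y N_minus[OF y(1)] scale_mem[OF y(1), of "-1"] G N
          by (intro convexD[OF convex_orbit_hull[OF F(1)]] sphere) (auto simp: field_simps)
        also have "((1 + N G) / 2) *\<^sub>R ?y + ((1 - N G) / 2) *\<^sub>R (- ?y)
            = ((1 + N G) / 2 - (1 - N G) / 2) *\<^sub>R ?y"
          by (simp add: scaleR_diff_left del: scaleR_scaleR)
        also have "\<dots> = G" using N by (simp add: field_simps)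
        finally show ?thesis .
      qed
    qed
  qed
  then show ?thesis by (auto simp: convex_transitive_def orbit_hull_def)
qed

end

lemma (in seminormed_subspace) seminormed_subspace_norm_closure:
  assumes S: "subspace S" "S \<subseteq> V"
  shows "seminormed_subspace (norm_closure V N S) N"
proof
  let ?W = "norm_closure V N S"
  have WV: "?W \<subseteq> V" by (rule norm_closure_subset)
  have "0 \<in> ?W" using subset_norm_closure[OF S(2)] S(1) by (auto dest: subspace_0)
  moreover have "x + y \<in> ?W" if *: "x \<in> ?W" "y \<in> ?W" for x y
  proof -
    have "\<exists>z\<in>S. N (z - (x + y)) < e" if "e > 0" for e
    proof -
      have "e / 2 > 0" using that by simp
      with * obtain x' y' where xy: "x' \<in> S" "N (x' - x) < e / 2" "y' \<in> S" "N (y' - y) < e / 2"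
        unfolding norm_closure_def by blast
      have "N ((x' - x) + (y' - y)) \<le> N (x' - x) + N (y' - y)"
        using xy S * WV by (intro triangle diff_mem) auto
      then have "N ((x' + y') - (x + y)) < e" using xy by (simp add: algebra_simps)
      then show ?thesis using xy S(1) by (blast intro: subspace_add)
    qed
    then show ?thesis using * WV by (auto simp: norm_closure_def add_mem)
  qed
  moreover have "c *\<^sub>R x \<in> ?W" if *: "x \<in> ?W" for c x
  proof -
    have "\<exists>z\<in>S. N (z - c *\<^sub>R x) < e" if "e > 0" for e
    proof -
      have "e / (\<bar>c\<bar> + 1) > 0" using that by simp
      with * obtain x' where x: "x' \<in> S" "N (x' - x) < e / (\<bar>c\<bar> + 1)"
        unfolding norm_closure_def by blast
      have V: "x' - x \<in> V" using x S * WV by (intro diff_mem) auto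
      have "N (c *\<^sub>R x' - c *\<^sub>R x) = \<bar>c\<bar> * N (x' - x)"
        using homogeneous[OF V, of c] by (simp add: scaleR_diff_right)
      also have "\<dots> \<le> (\<bar>c\<bar> + 1) * N (x' - x)"
        using N_nonneg[OF V] by (simp add: distrib_right)
      also have "\<dots> < e" using x(2) by (simp add: field_simps)
      finally show ?thesis using x(1) S(1) by (blast intro: subspace_scale)
    qed
    then show ?thesis using * WV by (auto simp: norm_closure_def scale_mem)
  qed
  ultimately show "subspace ?W" by (intro subspaceI)
qed (use norm_closure_subset in \<open>auto intro: triangle homogeneous\<close>)

section \<open>Nonsingular rearrangements of the unit interval\<close>

text \<open>
  An almost everywhere invertible transformation \<open>\<tau>\<close> with inverse \<open>\<sigma>\<close>, and \<open>w\<close> the density that turns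
  substitution of \<open>\<tau>\<close> into an identity of integrals.  The density of \<open>\<sigma>\<close> is determined by these data:
  it is \<open>1 / (w \<circ> \<sigma>)\<close>, as shown by \<open>rearrangement_inverse\<close>.
\<close>

definition rearrangement :: "(real \<Rightarrow> real) \<Rightarrow> (real \<Rightarrow> real) \<Rightarrow> (real \<Rightarrow> real) \<Rightarrow> bool" where
  "rearrangement \<tau> \<sigma> w \<longleftrightarrow>
     \<tau> \<in> unit_leb \<rightarrow>\<^sub>M unit_leb \<and> \<sigma> \<in> unit_leb \<rightarrow>\<^sub>M unit_leb \<and> w \<in> borel_measurable unit_leb \<and>
     (AE t in unit_leb. 0 < w t) \<and>
     (AE t in unit_leb. \<sigma> (\<tau> t) = t) \<and> (AE t in unit_leb. \<tau> (\<sigma> t) = t) \<and>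
     (\<forall>h\<in>borel_measurable unit_leb. (\<integral>\<^sup>+t. ennreal (w t) * h (\<tau> t) \<partial>unit_leb) = (\<integral>\<^sup>+t. h t \<partial>unit_leb))"

lemma rearrangementD:
  assumes "rearrangement \<tau> \<sigma> w"
  shows "\<tau> \<in> unit_leb \<rightarrow>\<^sub>M unit_leb" "\<sigma> \<in> unit_leb \<rightarrow>\<^sub>M unit_leb" "w \<in> borel_measurable unit_leb"
    "AE t in unit_leb. 0 < w t" "AE t in unit_leb. \<sigma> (\<tau> t) = t" "AE t in unit_leb. \<tau> (\<sigma> t) = t"
    "\<And>h. h \<in> borel_measurable unit_leb \<Longrightarrow>
      (\<integral>\<^sup>+t. ennreal (w t) * h (\<tau> t) \<partial>unit_leb) = (\<integral>\<^sup>+t. h t \<partial>unit_leb)"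
  using assms by (auto simp: rearrangement_def)

lemma AE_compose_nonsingular:
  assumes \<tau>: "\<tau> \<in> M \<rightarrow>\<^sub>M M" and null: "\<And>N. N \<in> null_sets M \<Longrightarrow> AE t in M. \<tau> t \<notin> N"
    and P: "AE t in M. P t"
  shows "AE t in M. P (\<tau> t)"
proof -
  from P obtain N where N: "N \<in> null_sets M" "{t \<in> space M. \<not> P t} \<subseteq> N"
    by (auto simp: eventually_ae_filter)
  from null[OF N(1)] AE_space show ?thesis
    by eventually_elim (use N measurable_space[OF \<tau>] in blast)
qed

text \<open>
  Because \<open>w\<close> is positive, the integral identity for the indicator function of a null set shows that its
  preimage is null.  This makes composition well defined on a.e. classes.
\<close>

lemma rearrangement_AE:
  assumes r: "rearrangement \<tau> \<sigma> w" and P: "AE t in unit_leb. P t"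
  shows "AE t in unit_leb. P (\<tau> t)"
proof (rule AE_compose_nonsingular[OF _ _ P])
  note [measurable] = rearrangementD(1,3)[OF r]
  show "\<tau> \<in> unit_leb \<rightarrow>\<^sub>M unit_leb" by measurable
  fix N assume N: "N \<in> null_sets unit_leb"
  have [measurable]: "N \<in> sets unit_leb" using N by auto
  have "(\<integral>\<^sup>+t. ennreal (w t) * indicator N (\<tau> t) \<partial>unit_leb) = (\<integral>\<^sup>+t. indicator N t \<partial>unit_leb)"
    by (intro rearrangementD(7)[OF r]) simp
  also have "\<dots> = 0" using N by auto
  finally have "AE t in unit_leb. ennreal (w t) * indicator N (\<tau> t) = 0"
    by (subst (asm) nn_integral_0_iff_AE) auto
  with rearrangementD(4)[OF r] show "AE t in unit_leb. \<tau> t \<notin> N"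
    by eventually_elim (auto simp: indicator_def split: if_splits)
qed

lemma rearrangement_AE_inverse:
  assumes r: "rearrangement \<tau> \<sigma> w" and P: "AE t in unit_leb. P t"
  shows "AE t in unit_leb. P (\<sigma> t)"
proof (rule AE_compose_nonsingular[OF _ _ P])
  note [measurable] = rearrangementD(1-3)[OF r]
  show "\<sigma> \<in> unit_leb \<rightarrow>\<^sub>M unit_leb" by measurable
  fix N assume N: "N \<in> null_sets unit_leb"
  have [measurable]: "N \<in> sets unit_leb" using N by auto
  have "(\<integral>\<^sup>+t. indicator N (\<sigma> t) \<partial>unit_leb) = (\<integral>\<^sup>+t. ennreal (w t) * indicator N (\<sigma> (\<tau> t)) \<partial>unit_leb)"
    by (intro rearrangementD(7)[OF r, symmetric]) simp
  also have "\<dots> = (\<integral>\<^sup>+t. 0 \<partial>unit_leb)"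
    by (intro nn_integral_cong_AE)
      (use rearrangementD(5)[OF r] AE_not_in[OF N] in \<open>eventually_elim, auto\<close>)
  also have "\<dots> = 0" by simp
  finally have "AE t in unit_leb. indicator N (\<sigma> t) = (0::ennreal)"
    by (subst (asm) nn_integral_0_iff_AE) auto
  then show "AE t in unit_leb. \<sigma> t \<notin> N"
    by eventually_elim (auto simp: indicator_def split: if_splits)
qed

lemma rearrangement_inverse:
  assumes r: "rearrangement \<tau> \<sigma> w"
  shows "rearrangement \<sigma> \<tau> (\<lambda>t. 1 / w (\<sigma> t))"
  unfolding rearrangement_def
proof (intro conjI ballI)
  note [measurable] = rearrangementD(1-3)[OF r]
  show "\<sigma> \<in> unit_leb \<rightarrow>\<^sub>M unit_leb" "\<tau> \<in> unit_leb \<rightarrow>\<^sub>M unit_leb"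
    "(\<lambda>t. 1 / w (\<sigma> t)) \<in> borel_measurable unit_leb" by measurable
  show "AE t in unit_leb. \<tau> (\<sigma> t) = t" "AE t in unit_leb. \<sigma> (\<tau> t) = t"
    using rearrangementD[OF r] by auto
  show "AE t in unit_leb. 0 < 1 / w (\<sigma> t)"
    using rearrangement_AE_inverse[OF r rearrangementD(4)[OF r]] by simp
  fix h :: "real \<Rightarrow> ennreal" assume [measurable]: "h \<in> borel_measurable unit_leb"
  have "(\<integral>\<^sup>+t. ennreal (1 / w (\<sigma> t)) * h (\<sigma> t) \<partial>unit_leb) =
      (\<integral>\<^sup>+t. ennreal (w t) * (ennreal (1 / w (\<sigma> (\<tau> t))) * h (\<sigma> (\<tau> t))) \<partial>unit_leb)"
    by (intro rearrangementD(7)[OF r, symmetric]) simp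
  also have "\<dots> = (\<integral>\<^sup>+t. h t \<partial>unit_leb)"
    by (intro nn_integral_cong_AE)
      (use rearrangementD(4,5)[OF r] in \<open>eventually_elim, simp flip: mult.assoc ennreal_mult''\<close>)
  finally show "(\<integral>\<^sup>+t. ennreal (1 / w (\<sigma> t)) * h (\<sigma> t) \<partial>unit_leb) = (\<integral>\<^sup>+t. h t \<partial>unit_leb)" .
qed

lemma sets_unit_leb_split:
  assumes "E \<in> sets unit_leb"
  obtains S N' where "S \<in> sets borel" "N' \<in> null_sets lborel" "S \<subseteq> E" "E \<subseteq> S \<union> N'" "E \<subseteq> {0..1}"
proof -
  have "E \<in> sets lebesgue" "E \<subseteq> {0..1}"
    using assms by (auto simp: sets_restrict_space_iff)
  from this(1) obtain S N N' where
    "E = S \<union> N" "N \<subseteq> N'" "N' \<in> null_sets lborel" "S \<in> sets lborel"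
    by (rule sets_completionE)
  then show ?thesis
    using \<open>E \<subseteq> {0..1}\<close> by (intro that[of S N']) auto
qed

lemma AE_lborel_unit_leb: "AE t in lborel. P t \<Longrightarrow> AE t in unit_leb. P t"
  using AE_completion[of P lborel] by (auto simp: AE_restrict_space_iff elim: eventually_mono)

lemma borel_unit_leb_measurable: "f \<in> borel \<rightarrow>\<^sub>M N \<Longrightarrow> f \<in> unit_leb \<rightarrow>\<^sub>M N"
  by (intro measurable_restrict_space1 measurable_completion) simp

text \<open>
  A Lebesgue measurable set is Borel up to a null set, and null sets have measurable preimages by
  completeness; without nonsingularity a Borel map need not be measurable for the completed measure.
\<close>

lemma nonsingular_measurable_unit_leb:
  assumes f: "f \<in> borel_measurable unit_leb" and range: "\<And>t. t \<in> {0..1} \<Longrightarrow> f t \<in> {0..1}"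
    and null: "\<And>N. N \<in> null_sets lborel \<Longrightarrow> AE t in unit_leb. f t \<notin> N"
  shows "f \<in> unit_leb \<rightarrow>\<^sub>M unit_leb"
proof (rule measurableI)
  show "f t \<in> space unit_leb" if "t \<in> space unit_leb" for t using that range by simp
  fix E assume "E \<in> sets unit_leb"
  then obtain S N' where E: "S \<in> sets borel" "N' \<in> null_sets lborel" "S \<subseteq> E" "E \<subseteq> S \<union> N'"
    by (rule sets_unit_leb_split) blast
  have "f -` S \<inter> space unit_leb \<in> sets unit_leb" using f E(1) by (rule measurable_sets)
  moreover have "AE t in unit_leb. t \<in> f -` S \<inter> space unit_leb \<longleftrightarrow> t \<in> f -` E \<inter> space unit_leb"
    using null[OF E(2)] by eventually_elim (use E in blast)
  ultimately show "f -` E \<inter> space unit_leb \<in> sets unit_leb"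
    using complete_measure.in_sets_AE[OF complete_measure_unit_leb] by blast
qed

lemma nn_integral_unit_leb_open:
  assumes [measurable]: "f \<in> borel_measurable borel"
  shows "(\<integral>\<^sup>+t. f t \<partial>unit_leb) = (\<integral>\<^sup>+t. f t \<partial>restrict_space lborel {0<..<1})"
proof -
  have "(\<integral>\<^sup>+t. f t \<partial>unit_leb) = (\<integral>\<^sup>+t. f t * indicator {0..1} t \<partial>lborel)"
    by (simp add: nn_integral_restrict_space nn_integral_completion)
  also have "\<dots> = (\<integral>\<^sup>+t. f t * indicator {0<..<1} t \<partial>lborel)"
    by (intro nn_integral_cong_AE)
      (use AE_lborel_singleton[of 0] AE_lborel_singleton[of 1] in \<open>eventually_elim, auto simp: indicator_def\<close>)
  also have "\<dots> = (\<integral>\<^sup>+t. f t \<partial>restrict_space lborel {0<..<1})"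
    by (simp add: nn_integral_restrict_space)
  finally show ?thesis .
qed

lemma AE_unit_leb_open:
  assumes "AE t in restrict_space lborel {0<..<1}. P t"
  shows "AE t in unit_leb. P t"
proof -
  have "AE t in lborel. t \<in> {0<..<1} \<longrightarrow> P t"
    using assms by (simp add: AE_restrict_space_iff)
  then have "AE t in unit_leb. t \<in> {0<..<1} \<longrightarrow> P t" by (rule AE_lborel_unit_leb)
  moreover have "AE t in unit_leb. t \<noteq> 0" "AE t in unit_leb. t \<noteq> 1"
    by (intro AE_lborel_unit_leb AE_lborel_singleton)+
  moreover have "AE t in unit_leb. t \<in> {0..1}" using AE_space[of unit_leb] by simp
  ultimately show ?thesis by eventually_elim auto
qed

text \<open>
  The distribution function \<open>C\<close> of \<open>\<psi>\<close> under the density \<open>g\<close> carries \<open>g\<close> to Lebesgue measure, and its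
  quantile function \<open>I\<close> carries Lebesgue measure back.  As \<open>\<psi>\<close> is injective, its distribution has no
  atoms, so \<open>C\<close> is continuous and \<open>C (I u) = u\<close>.  The opposite relation holds almost everywhere, since
  the distribution of \<open>\<psi>\<close> is that of \<open>I\<close>.  The coordinate \<open>\<psi>\<close> decides in which order the points of
  the interval are laid out.
\<close>

lemma rearrangement_exists:
  fixes g \<psi> \<phi> :: "real \<Rightarrow> real"
  assumes g [measurable]: "g \<in> borel_measurable unit_leb" and g_pos: "AE t in unit_leb. 0 < g t"
    and g_int: "(\<integral>\<^sup>+t. ennreal (g t) \<partial>unit_leb) = 1"
    and \<psi> [measurable]: "\<psi> \<in> borel_measurable borel" and \<phi> [measurable]: "\<phi> \<in> borel_measurable borel"
    and inv: "\<And>t. t \<in> {0..1} \<Longrightarrow> \<phi> (\<psi> t) = t"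
  obtains \<tau> where
    "rearrangement \<tau> (\<lambda>t. measure (density unit_leb g) {s \<in> {0..1}. \<psi> s \<le> \<psi> t}) (\<lambda>u. 1 / g (\<tau> u))"
proof -
  let ?G = "density unit_leb g" and ?U = "restrict_space lborel {0<..<1::real}"
  define M where "M = distr ?G borel \<psi>"
  note [measurable] = borel_unit_leb_measurable[OF \<psi>] borel_unit_leb_measurable[OF \<phi>]
  have "prob_space ?G" by (rule prob_spaceI) (use g_int in \<open>simp add: emeasure_density cong: nn_integral_cong_simp\<close>)
  then have "real_distribution M" unfolding M_def
    by (rule prob_space.real_distribution_distr) simp
  then interpret cdf_distribution M unfolding cdf_distribution_def .
  have C_eq: "C x = measure ?G {s \<in> {0..1}. \<psi> s \<le> x}" for x
    unfolding cdf_def M_def by (subst measure_distr) (auto intro!: arg_cong[where f = "measure _"])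
  have no_atom: "measure M {x} = 0" for x
  proof -
    have "AE t in unit_leb. t \<noteq> \<phi> x" by (intro AE_lborel_unit_leb AE_lborel_singleton)
    moreover have "AE t in unit_leb. t \<in> {0..1}" using AE_space[of unit_leb] by simp
    ultimately have "AE t in unit_leb. 0 < ennreal (g t) \<longrightarrow> \<psi> t \<noteq> x"
      by eventually_elim (use inv in auto)
    then have "AE t in M. t \<noteq> x" unfolding M_def by (simp add: AE_distr_iff AE_density)
    then show ?thesis by (simp add: prob_eq_0)
  qed
  have C_I: "C (I u) = u" if u: "u \<in> {0<..<1}" for u
  proof (rule antisym)
    show "u \<le> C (I u)" using pseudoinverse[of u "I u"] u by simp
    have "isCont C (I u)" using no_atom by (simp add: isCont_cdf)
    then have "(C \<longlongrightarrow> C (I u)) (at_left (I u))"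
      by (auto simp: isCont_def intro: filterlim_mono at_le)
    moreover have below: "C x \<le> u" if "x < I u" for x
      using pseudoinverse[of u x] that u by simp
    then have "\<forall>\<^sub>F x in at_left (I u). C x \<le> u"
      by (simp add: eventually_at_filter)
    ultimately show "C (I u) \<le> u"
      by (intro tendsto_upperbound) auto
  qed
  \<comment> \<open>Outside the open unit interval the infimum may range over an empty or an unbounded set.\<close>
  define J where "J u = (if u \<in> {0<..<1} then I u else 0)" for u :: real
  have J [measurable]: "J \<in> borel_measurable borel"
    unfolding J_def using measurable_CI by (subst (asm) measurable_restrict_space_iff[where c = 0]) auto
  \<comment> \<open>The truncation changes \<open>\<tau>\<close> on a null set only and makes it a self-map of the interval.\<close>
  define \<tau> where "\<tau> u = max 0 (min 1 (\<phi> (J u)))" for u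
  have [measurable]: "\<tau> \<in> borel_measurable borel" unfolding \<tau>_def by measurable
  note [measurable] = borel_unit_leb_measurable[OF \<open>\<tau> \<in> borel_measurable borel\<close>]
  have distr_J: "distr ?U borel J = M"
  proof -
    have "distr ?U borel J = distr ?U borel I"
      by (rule distr_cong) (auto simp: J_def space_restrict_space)
    then show ?thesis by (simp add: distr_I_eq_M)
  qed
  have J_meas [measurable]: "J \<in> borel_measurable ?U" by (intro measurable_restrict_space1) simp
  \<comment> \<open>\<open>\<psi>\<close> under \<open>g\<close> and \<open>J\<close> under Lebesgue measure have the same distribution \<open>M\<close>.\<close>
  have transfer: "AE t in unit_leb. P (\<psi> t)" if [measurable]: "Measurable.pred borel P"
    and ae: "AE u in ?U. P (J u)" for P
  proof -
    have "AE x in M. P x" using ae by (subst distr_J[symmetric]) (simp add: AE_distr_iff)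
    then have "AE t in unit_leb. 0 < ennreal (g t) \<longrightarrow> P (\<psi> t)"
      unfolding M_def by (simp add: AE_distr_iff AE_density)
    with g_pos show ?thesis by eventually_elim simp
  qed
  have U_mem: "AE u in ?U. u \<in> {0<..<1}" using AE_space[of ?U] by (simp add: space_restrict_space)
  have unit: "AE t in unit_leb. t \<in> {0..1}" using AE_space[of unit_leb] by simp
  have \<psi>_\<tau>: "AE u in unit_leb. u \<in> {0<..<1} \<and> \<psi> (\<tau> u) = I u"
  proof (rule AE_unit_leb_open)
    have "AE t in unit_leb. 0 < ennreal (g t) \<longrightarrow> \<psi> (max 0 (min 1 (\<phi> (\<psi> t)))) = \<psi> t"
      using unit by eventually_elim (simp add: inv)
    then have "AE x in M. \<psi> (max 0 (min 1 (\<phi> x))) = x"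
      unfolding M_def by (simp add: AE_distr_iff AE_density)
    then have "AE u in ?U. \<psi> (max 0 (min 1 (\<phi> (J u)))) = J u"
      by (subst (asm) distr_J[symmetric]) (simp add: AE_distr_iff)
    with U_mem show "AE u in ?U. u \<in> {0<..<1} \<and> \<psi> (\<tau> u) = I u"
      by eventually_elim (simp add: \<tau>_def J_def)
  qed
  have \<tau>_int: "(\<integral>\<^sup>+u. k (\<tau> u) \<partial>unit_leb) = (\<integral>\<^sup>+t. ennreal (g t) * k t \<partial>unit_leb)"
    if [measurable]: "k \<in> borel_measurable borel" for k
  proof -
    have [measurable]: "k \<in> borel_measurable unit_leb" by (intro borel_unit_leb_measurable) simp
    have "(\<integral>\<^sup>+u. k (\<tau> u) \<partial>unit_leb) = (\<integral>\<^sup>+u. k (max 0 (min 1 (\<phi> (J u)))) \<partial>?U)"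
      by (subst nn_integral_unit_leb_open) (simp_all add: \<tau>_def)
    also have "\<dots> = (\<integral>\<^sup>+x. k (max 0 (min 1 (\<phi> x))) \<partial>M)"
      by (subst distr_J[symmetric]) (simp add: nn_integral_distr)
    also have "\<dots> = (\<integral>\<^sup>+t. ennreal (g t) * k (max 0 (min 1 (\<phi> (\<psi> t)))) \<partial>unit_leb)"
      unfolding M_def by (simp add: nn_integral_distr nn_integral_density)
    also have "\<dots> = (\<integral>\<^sup>+t. ennreal (g t) * k t \<partial>unit_leb)"
      by (intro nn_integral_cong) (simp add: inv)
    finally show ?thesis .
  qed
  have \<tau>_null: "AE u in unit_leb. \<tau> u \<notin> N" if N: "N \<in> null_sets lborel" for N
  proof -
    have [measurable]: "N \<in> sets borel" using N by auto
    have "(\<integral>\<^sup>+u. indicator N (\<tau> u) \<partial>unit_leb) = (\<integral>\<^sup>+t. ennreal (g t) * indicator N t \<partial>unit_leb)"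
      by (rule \<tau>_int) simp
    also have "\<dots> = (\<integral>\<^sup>+t. 0 \<partial>unit_leb)"
      by (intro nn_integral_cong_AE)
        (use AE_lborel_unit_leb[OF AE_not_in[OF N]] in \<open>eventually_elim, simp\<close>)
    also have "\<dots> = 0" by simp
    finally have "AE t in unit_leb. indicator N (\<tau> t) = (0::ennreal)"
      by (subst (asm) nn_integral_0_iff_AE) auto
    then show ?thesis
      by eventually_elim (auto simp: indicator_def split: if_splits)
  qed
  have \<tau>_meas [measurable]: "\<tau> \<in> unit_leb \<rightarrow>\<^sub>M unit_leb"
    by (rule nonsingular_measurable_unit_leb[OF borel_unit_leb_measurable _ \<tau>_null])
      (measurable, auto simp: \<tau>_def)
  \<comment> \<open>\<open>\<tau>_int\<close> covers Borel integrands; equality of measures extends it to Lebesgue measurable ones.\<close>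
  have distr_\<tau>: "distr unit_leb unit_leb \<tau> = ?G"
  proof (rule measure_eqI)
    fix E assume "E \<in> sets (distr unit_leb unit_leb \<tau>)"
    then have E [measurable]: "E \<in> sets unit_leb" by simp
    then obtain S N' where S: "S \<in> sets borel" "N' \<in> null_sets lborel" "S \<subseteq> E" "E \<subseteq> S \<union> N'" "E \<subseteq> {0..1}"
      by (rule sets_unit_leb_split)
    then have [measurable]: "S \<in> sets borel" "N' \<in> sets borel" by auto
    have "S \<in> sets unit_leb" using S by (auto simp: sets_restrict_space_iff)
    note [measurable] = this
    have N'_E: "AE t in unit_leb. t \<in> S \<longleftrightarrow> t \<in> E"
      using AE_lborel_unit_leb[OF AE_not_in[OF S(2)]] by eventually_elim (use S in blast)
    from \<tau>_null[OF S(2)] have N'_\<tau>: "AE t in unit_leb. \<tau> t \<in> S \<longleftrightarrow> \<tau> t \<in> E"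
      by eventually_elim (use S in blast)
    have "emeasure (distr unit_leb unit_leb \<tau>) E = (\<integral>\<^sup>+u. indicator E (\<tau> u) \<partial>unit_leb)"
      by (simp add: nn_integral_distr flip: nn_integral_indicator)
    also have "\<dots> = (\<integral>\<^sup>+u. indicator S (\<tau> u) \<partial>unit_leb)"
      by (intro nn_integral_cong_AE) (use N'_\<tau> in \<open>eventually_elim, simp add: indicator_def\<close>)
    also have "\<dots> = (\<integral>\<^sup>+t. ennreal (g t) * indicator S t \<partial>unit_leb)"
      by (rule \<tau>_int) simp
    also have "\<dots> = (\<integral>\<^sup>+t. ennreal (g t) * indicator E t \<partial>unit_leb)"
      by (intro nn_integral_cong_AE) (use N'_E in \<open>eventually_elim, simp add: indicator_def\<close>)
    also have "\<dots> = emeasure ?G E" by (simp add: emeasure_density)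
    finally show "emeasure (distr unit_leb unit_leb \<tau>) E = emeasure ?G E" .
  qed simp
  have \<tau>_int': "(\<integral>\<^sup>+u. k (\<tau> u) \<partial>unit_leb) = (\<integral>\<^sup>+t. ennreal (g t) * k t \<partial>unit_leb)"
    if [measurable]: "k \<in> borel_measurable unit_leb" for k
    using arg_cong[OF distr_\<tau>, of "\<lambda>M. nn_integral M k"]
    by (simp add: nn_integral_distr nn_integral_density)
  have C_\<psi> [measurable]: "(\<lambda>t. C (\<psi> t)) \<in> unit_leb \<rightarrow>\<^sub>M unit_leb"
  proof (rule nonsingular_measurable_unit_leb)
    fix N :: "real set" assume N: "N \<in> null_sets lborel"
    then have [measurable]: "N \<in> sets borel" by auto
    show "AE t in unit_leb. C (\<psi> t) \<notin> N"
    proof (rule transfer)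
      have "AE u in ?U. u \<notin> N" using AE_not_in[OF N]
        by (auto simp: AE_restrict_space_iff elim: eventually_mono)
      with U_mem show "AE u in ?U. C (J u) \<notin> N"
        by eventually_elim (simp add: J_def C_I)
    qed measurable
  qed (auto simp: cdf_nonneg cdf_bounded_prob)
  have "rearrangement \<tau> (\<lambda>t. C (\<psi> t)) (\<lambda>u. 1 / g (\<tau> u))"
    unfolding rearrangement_def
  proof (intro conjI ballI)
    have g_pos_\<tau>: "AE u in unit_leb. 0 < g (\<tau> u)"
    proof -
      have "AE t in distr unit_leb unit_leb \<tau>. 0 < g t"
        unfolding distr_\<tau> using g_pos by (auto simp: AE_density elim: eventually_mono)
      then show ?thesis by (rule AE_distrD[OF \<tau>_meas])
    qed
    then show "AE u in unit_leb. 0 < 1 / g (\<tau> u)" by simp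
    show "AE u in unit_leb. C (\<psi> (\<tau> u)) = u" using \<psi>_\<tau> by eventually_elim (simp add: C_I)
    have "AE t in unit_leb. C (\<psi> t) \<in> {0<..<1} \<and> J (C (\<psi> t)) = \<psi> t"
    proof (rule transfer)
      show "AE u in ?U. C (J u) \<in> {0<..<1} \<and> J (C (J u)) = J u"
        using U_mem by eventually_elim (simp add: J_def C_I)
    qed measurable
    with unit show "AE t in unit_leb. \<tau> (C (\<psi> t)) = t"
      by eventually_elim (simp add: \<tau>_def inv)
    fix h :: "real \<Rightarrow> ennreal" assume [measurable]: "h \<in> borel_measurable unit_leb"
    have "(\<integral>\<^sup>+u. ennreal (1 / g (\<tau> u)) * h (\<tau> u) \<partial>unit_leb) =
        (\<integral>\<^sup>+t. ennreal (g t) * (ennreal (1 / g t) * h t) \<partial>unit_leb)"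
      by (rule \<tau>_int') simp
    also have "\<dots> = (\<integral>\<^sup>+t. h t \<partial>unit_leb)"
      by (intro nn_integral_cong_AE)
        (use g_pos in \<open>eventually_elim, simp flip: mult.assoc ennreal_mult''\<close>)
    finally show "(\<integral>\<^sup>+u. ennreal (1 / g (\<tau> u)) * h (\<tau> u) \<partial>unit_leb) = (\<integral>\<^sup>+t. h t \<partial>unit_leb)" .
  qed measurable
  then show ?thesis by (intro that[of \<tau>]) (simp add: C_eq)
qed

section \<open>Operators on classes of strongly measurable functions\<close>

abbreviation sm :: "(real \<Rightarrow> 'a::real_normed_vector) \<Rightarrow> bool" where
  "sm \<equiv> strongly_measurable unit_leb"

lemma ae_rel_refl: "ae_rel f f \<longleftrightarrow> sm f"
  by (simp add: ae_rel_def)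

lemma L0_cases:
  obtains f where "sm f" "F = abs_L0 f"
proof -
  have "ae_rel (rep_L0 F) (rep_L0 F)" "abs_L0 (rep_L0 F) = F"
    using Quotient_rep_reflp[OF Quotient_L0] Quotient_abs_rep[OF Quotient_L0] by auto
  then show ?thesis using that by (simp add: ae_rel_refl)
qed

lemma abs_L0_eq_iff:
  assumes "sm f" "sm g"
  shows "abs_L0 f = abs_L0 g \<longleftrightarrow> (AE t in unit_leb. f t = g t)"
  using Quotient_rel[OF Quotient_L0, of f g] assms by (auto simp: ae_rel_def)

lemma sm_diff: "sm f \<Longrightarrow> sm g \<Longrightarrow> sm (\<lambda>t. f t - g t)"
  using strongly_measurable_add[of unit_leb f "\<lambda>t. - g t"] strongly_measurable_uminus[of unit_leb g] by simp

lemma abs_L0_add: "sm f \<Longrightarrow> sm g \<Longrightarrow> abs_L0 f + abs_L0 g = abs_L0 (\<lambda>t. f t + g t)"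
  by (rule plus_L0.abs_eq) (simp_all add: ae_rel_refl)

lemma abs_L0_scale: "sm f \<Longrightarrow> c *\<^sub>R abs_L0 f = abs_L0 (\<lambda>t. c *\<^sub>R f t)"
  by (rule scaleR_L0.abs_eq) (simp add: ae_rel_refl)

lemma abs_L0_diff: "sm f \<Longrightarrow> sm g \<Longrightarrow> abs_L0 f - abs_L0 g = abs_L0 (\<lambda>t. f t - g t)"
  by (simp add: minus_L0_def uminus_L0.abs_eq ae_rel_refl abs_L0_add strongly_measurable_uminus)

definition lift_op :: "((real \<Rightarrow> 'a) \<Rightarrow> real \<Rightarrow> 'a) \<Rightarrow> 'a::real_normed_vector L0 \<Rightarrow> 'a L0" where
  "lift_op \<Phi> F = abs_L0 (\<Phi> (rep_L0 F))"

text \<open>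
  Additivity and homogeneity are required at every point rather than almost everywhere.  The operators
  below act pointwise, so they satisfy this form, which spares null sets in linear computations.
\<close>

definition ae_operator :: "((real \<Rightarrow> 'a) \<Rightarrow> real \<Rightarrow> 'a::real_normed_vector) \<Rightarrow> bool" where
  "ae_operator \<Phi> \<longleftrightarrow>
     (\<forall>f. sm f \<longrightarrow> sm (\<Phi> f)) \<and>
     (\<forall>f g. (AE t in unit_leb. f t = g t) \<longrightarrow> (AE t in unit_leb. \<Phi> f t = \<Phi> g t)) \<and>
     (\<forall>f g t. \<Phi> (\<lambda>t. f t + g t) t = \<Phi> f t + \<Phi> g t) \<and>
     (\<forall>c f t. \<Phi> (\<lambda>t. c *\<^sub>R f t) t = c *\<^sub>R \<Phi> f t)"

lemma ae_operatorD:
  assumes "ae_operator \<Phi>"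
  shows "sm f \<Longrightarrow> sm (\<Phi> f)"
    "AE t in unit_leb. f t = g t \<Longrightarrow> AE t in unit_leb. \<Phi> f t = \<Phi> g t"
    "\<Phi> (\<lambda>t. f t + g t) t = \<Phi> f t + \<Phi> g t" "\<Phi> (\<lambda>t. c *\<^sub>R f t) t = c *\<^sub>R \<Phi> f t"
    "\<Phi> (\<lambda>t. f t - g t) t = \<Phi> f t - \<Phi> g t"
proof -
  show *: "\<Phi> (\<lambda>t. f t + g t) t = \<Phi> f t + \<Phi> g t" "\<Phi> (\<lambda>t. c *\<^sub>R f t) t = c *\<^sub>R \<Phi> f t" for f g t c
    using assms by (simp_all add: ae_operator_def)
  show "\<Phi> (\<lambda>t. f t - g t) t = \<Phi> f t - \<Phi> g t"
    using *(1)[of f "\<lambda>t. (-1) *\<^sub>R g t" t] *(2)[of "-1" g t] by simp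
qed (use assms in \<open>simp_all add: ae_operator_def\<close>)

lemma lift_op_abs:
  assumes \<Phi>: "ae_operator \<Phi>" and f: "sm f"
  shows "lift_op \<Phi> (abs_L0 f) = abs_L0 (\<Phi> f)"
proof -
  have "ae_rel (rep_L0 (abs_L0 f)) f"
    using f by (simp add: Quotient_rep_abs[OF Quotient_L0] ae_rel_refl)
  then have "sm (rep_L0 (abs_L0 f))" "AE t in unit_leb. rep_L0 (abs_L0 f) t = f t"
    by (auto simp: ae_rel_def)
  then show ?thesis
    using \<Phi> f by (simp add: lift_op_def abs_L0_eq_iff ae_operator_def)
qed

text \<open>
  An isometric automorphism has to be onto, so the operator comes with an inverse \<open>\<Psi>\<close>, which must also
  map \<open>V\<close> into itself.
\<close>

lemma isometric_automorphism_lift_op: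
  assumes \<Phi>: "ae_operator \<Phi>" and \<Psi>: "ae_operator \<Psi>"
    and inv: "\<And>f. sm f \<Longrightarrow> AE t in unit_leb. \<Psi> (\<Phi> f) t = f t"
      "\<And>f. sm f \<Longrightarrow> AE t in unit_leb. \<Phi> (\<Psi> f) t = f t"
    and mem: "\<And>f. \<lbrakk>sm f; abs_L0 f \<in> V\<rbrakk> \<Longrightarrow> abs_L0 (\<Phi> f) \<in> V"
      "\<And>f. \<lbrakk>sm f; abs_L0 f \<in> V\<rbrakk> \<Longrightarrow> abs_L0 (\<Psi> f) \<in> V"
    and N: "\<And>f. \<lbrakk>sm f; abs_L0 f \<in> V\<rbrakk> \<Longrightarrow> N (abs_L0 (\<Phi> f)) = N (abs_L0 f)"
  shows "isometric_automorphism V N (lift_op \<Phi>)"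
  unfolding isometric_automorphism_def
proof (intro conjI ballI allI)
  have sm: "sm f \<Longrightarrow> sm (\<Phi> f)" "sm f \<Longrightarrow> sm (\<Psi> f)" for f
    using \<Phi> \<Psi> by (auto simp: ae_operator_def)
  show "bij_betw (lift_op \<Phi>) V V"
  proof (rule bij_betwI[where g = "lift_op \<Psi>"])
    show "lift_op \<Phi> \<in> V \<rightarrow> V" "lift_op \<Psi> \<in> V \<rightarrow> V"
      using mem by (auto simp: lift_op_abs[OF \<Phi>] lift_op_abs[OF \<Psi>] intro: L0_cases) (metis L0_cases lift_op_abs \<Phi> \<Psi>)+
    fix F :: "'a L0"
    obtain f where f: "sm f" "F = abs_L0 f" by (rule L0_cases)
    then show "lift_op \<Psi> (lift_op \<Phi> F) = F" "lift_op \<Phi> (lift_op \<Psi> F) = F"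
      using inv[OF f(1)] by (simp_all add: lift_op_abs[OF \<Phi>] lift_op_abs[OF \<Psi>] sm abs_L0_eq_iff)
  qed
  fix F G :: "'a L0" and c
  obtain f g where fg: "sm f" "F = abs_L0 f" "sm g" "G = abs_L0 g" by (metis L0_cases)
  then show "lift_op \<Phi> (F + G) = lift_op \<Phi> F + lift_op \<Phi> G"
    using \<Phi> by (simp add: abs_L0_add lift_op_abs[OF \<Phi>] strongly_measurable_add sm abs_L0_eq_iff)
      (simp add: ae_operator_def)
  show "lift_op \<Phi> (c *\<^sub>R F) = c *\<^sub>R lift_op \<Phi> F"
    using \<Phi> fg by (simp add: abs_L0_scale lift_op_abs[OF \<Phi>] strongly_measurable_scaleR sm abs_L0_eq_iff)
      (simp add: ae_operator_def)
  assume "F \<in> V"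
  then show "N (lift_op \<Phi> F) = N F" using N fg by (simp add: lift_op_abs[OF \<Phi>])
qed

definition patch_op :: "real set \<Rightarrow> ('a \<Rightarrow> 'a) \<Rightarrow> (real \<Rightarrow> 'a) \<Rightarrow> real \<Rightarrow> 'a" where
  "patch_op B T f t = (if t \<in> B then T (f t) else f t)"

definition compose_op ::
  "(real \<Rightarrow> real) \<Rightarrow> (real \<Rightarrow> real) \<Rightarrow> (real \<Rightarrow> 'a::real_normed_vector) \<Rightarrow> real \<Rightarrow> 'a" where
  "compose_op v \<tau> f t = v t *\<^sub>R f (\<tau> t)"

lemma isometry_UNIV:
  fixes T :: "'a::real_normed_vector \<Rightarrow> 'a"
  assumes "isometric_automorphism UNIV norm T"
  shows "T (x + y) = T x + T y" "T (c *\<^sub>R x) = c *\<^sub>R T x" "norm (T x) = norm x" "bounded_linear T"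
proof -
  show *: "T (x + y) = T x + T y" "T (c *\<^sub>R x) = c *\<^sub>R T x" "norm (T x) = norm x" for x y c
    using assms by (auto simp: isometric_automorphism_def)
  show "bounded_linear T" by (rule bounded_linear_intro[where K = 1]) (auto simp: *)
qed

lemma simple_function_patch_op:
  assumes "B \<in> sets unit_leb" "simple_function unit_leb f"
  shows "simple_function unit_leb (patch_op B T f)"
proof -
  have "simple_function unit_leb (\<lambda>t. if t \<in> B then T (f t) else f t)"
    using assms by (intro simple_function_If_set simple_function_compose1[OF assms(2)])
      (auto simp: sets.Int_space_eq2)
  then show ?thesis by (simp add: patch_op_def[abs_def])
qed

lemma ae_operator_patch_op:
  fixes T :: "'a::real_normed_vector \<Rightarrow> 'a"
  assumes B: "B \<in> sets unit_leb" and T: "isometric_automorphism UNIV norm T"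
  shows "ae_operator (patch_op B T)"
  unfolding ae_operator_def
proof (intro conjI allI impI)
  fix f g :: "real \<Rightarrow> 'a" and c t
  note T = isometry_UNIV[OF T]
  show "patch_op B T (\<lambda>t. f t + g t) t = patch_op B T f t + patch_op B T g t"
    "patch_op B T (\<lambda>t. c *\<^sub>R f t) t = c *\<^sub>R patch_op B T f t"
    by (simp_all add: patch_op_def T)
  show "AE t in unit_leb. patch_op B T f t = patch_op B T g t" if "AE t in unit_leb. f t = g t"
    using that by eventually_elim (simp add: patch_op_def)
  assume "sm f"
  then obtain s where s: "\<And>i. simple_function unit_leb (s i)"
    "AE t in unit_leb. (\<lambda>i::nat. s i t) \<longlonglongrightarrow> f t"
    unfolding strongly_measurable_def by blast
  from s(2) have "AE t in unit_leb. (\<lambda>i. patch_op B T (s i) t) \<longlonglongrightarrow> patch_op B T f t"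
    by eventually_elim (auto simp: patch_op_def intro: bounded_linear.tendsto[OF T(4)])
  then show "sm (patch_op B T f)"
    unfolding strongly_measurable_def using simple_function_patch_op[OF B s(1)]
    by (intro exI[of _ "\<lambda>i. patch_op B T (s i)"]) blast
qed

lemma ae_operator_compose_op:
  assumes r: "rearrangement \<tau> \<sigma> w" and v: "v \<in> borel_measurable unit_leb"
  shows "ae_operator (compose_op v \<tau> :: (real \<Rightarrow> 'a::real_normed_vector) \<Rightarrow> _)"
  unfolding ae_operator_def
proof (intro conjI allI impI)
  fix f g :: "real \<Rightarrow> 'a" and c t
  show "compose_op v \<tau> (\<lambda>t. f t + g t) t = compose_op v \<tau> f t + compose_op v \<tau> g t"
    "compose_op v \<tau> (\<lambda>t. c *\<^sub>R f t) t = c *\<^sub>R compose_op v \<tau> f t"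
    by (simp_all add: compose_op_def scaleR_add_right)
  show "AE t in unit_leb. compose_op v \<tau> f t = compose_op v \<tau> g t" if "AE t in unit_leb. f t = g t"
    using rearrangement_AE[OF r that] by eventually_elim (simp add: compose_op_def)
  assume "sm f"
  then obtain s where s: "\<And>i. simple_function unit_leb (s i)"
    "AE t in unit_leb. (\<lambda>i::nat. s i t) \<longlonglongrightarrow> f t"
    unfolding strongly_measurable_def by blast
  from borel_measurable_implies_sequence_metric[OF v, of 0] obtain v' where
    v': "\<And>i. simple_function unit_leb (v' i)" "\<And>t. t \<in> space unit_leb \<Longrightarrow> (\<lambda>i. v' i t) \<longlonglongrightarrow> v t"
    by blast
  have "simple_function unit_leb (\<lambda>t. v' i t *\<^sub>R s i (\<tau> t))" for i
    by (intro simple_function_compose2[where h = scaleR] v' simple_function_comp[OF _ s(1)]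
      rearrangementD(1)[OF r])
  moreover have "AE t in unit_leb. (\<lambda>i. v' i t *\<^sub>R s i (\<tau> t)) \<longlonglongrightarrow> compose_op v \<tau> f t"
    using rearrangement_AE[OF r s(2)] AE_space
    by eventually_elim (auto simp: compose_op_def intro!: tendsto_scaleR v')
  ultimately show "sm (compose_op v \<tau> f)"
    unfolding strongly_measurable_def by (intro exI[of _ "\<lambda>i t. v' i t *\<^sub>R s i (\<tau> t)"]) blast
qed

lemma patch_op_inverse:
  fixes T :: "'a::real_normed_vector \<Rightarrow> 'a"
  assumes T: "isometric_automorphism UNIV norm T"
  shows "isometric_automorphism UNIV norm (inv_into UNIV T)"
    "patch_op B (inv_into UNIV T) (patch_op B T f) = f" "patch_op B T (patch_op B (inv_into UNIV T) f) = f"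
proof -
  interpret seminormed_subspace "UNIV :: 'a set" norm
    by standard (auto intro: norm_triangle_ineq)
  show "isometric_automorphism UNIV norm (inv_into UNIV T)"
    using T by (rule isometric_automorphism_inverse)
  have "bij T" using T by (simp add: isometric_automorphism_def)
  then show "patch_op B (inv_into UNIV T) (patch_op B T f) = f" "patch_op B T (patch_op B (inv_into UNIV T) f) = f"
    by (auto simp: patch_op_def fun_eq_iff bij_is_inj bij_is_surj surj_f_inv_f)
qed

lemma compose_op_inverse:
  assumes r: "rearrangement \<tau> \<sigma> w" and v: "AE t in unit_leb. v t \<noteq> 0"
  shows "AE t in unit_leb. compose_op (\<lambda>t. 1 / v (\<sigma> t)) \<sigma> (compose_op v \<tau> f) t = f t"
    "AE t in unit_leb. compose_op v \<tau> (compose_op (\<lambda>t. 1 / v (\<sigma> t)) \<sigma> f) t = f t"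
proof -
  show "AE t in unit_leb. compose_op (\<lambda>t. 1 / v (\<sigma> t)) \<sigma> (compose_op v \<tau> f) t = f t"
    using rearrangement_AE_inverse[OF r v] rearrangementD(6)[OF r]
    by eventually_elim (simp add: compose_op_def)
  show "AE t in unit_leb. compose_op v \<tau> (compose_op (\<lambda>t. 1 / v (\<sigma> t)) \<sigma> f) t = f t"
    using v rearrangementD(5)[OF r]
    by eventually_elim (simp add: compose_op_def)
qed

section \<open>Changing the values of simple functions by pointwise isometries\<close>

text \<open>
  What the spaces \<open>L\<^sup>p\<close> and \<open>L\<^sub>s\<^sup>\<infinity>\<close> have in common.  The bound on simple functions makes a constant
  value on a set depend continuously on a vector of \<open>X\<close>.
\<close>

locale L0_function_space = seminormed_subspace V N
  for V :: "'a::real_normed_vector L0 set" and N :: "'a L0 \<Rightarrow> real" +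
  assumes simple_mem: "simple_function unit_leb f \<Longrightarrow> abs_L0 f \<in> V"
    and bounded: "\<lbrakk>simple_function unit_leb f; \<And>t. norm (f t) \<le> c\<rbrakk> \<Longrightarrow> N (abs_L0 f) \<le> c"
    and patch: "\<lbrakk>B \<in> sets unit_leb; isometric_automorphism UNIV norm T\<rbrakk>
      \<Longrightarrow> isometric_automorphism V N (lift_op (patch_op B T))"
begin

text \<open>
  The admissible values on \<open>B\<close> form a closed convex set.  It contains the orbit of \<open>u\<close>, because
  isometries of \<open>X\<close> can be applied on \<open>B\<close> alone, and therefore the unit ball of \<open>X\<close>.
\<close>

lemma patch_value:
  assumes X: "convex_transitive (UNIV :: 'a set) norm" and F: "F \<in> V"
    and f: "simple_function unit_leb f" "abs_L0 f \<in> orbit_hull F"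
    and B: "B \<in> sets unit_leb" and u: "\<And>t. t \<in> B \<Longrightarrow> f t = u" "norm u = 1" and v: "norm v \<le> 1"
  shows "abs_L0 (\<lambda>t. if t \<in> B then v else f t) \<in> orbit_hull F"
proof -
  define P where "P y = (\<lambda>t. if t \<in> B then y else f t)" for y
  have simple: "simple_function unit_leb (P y)" for y
    unfolding P_def using B f(1) by (intro simple_function_If_set) auto
  note sm = strongly_measurable_simple[OF simple] strongly_measurable_simple[OF f(1)]
  let ?D = "{y. abs_L0 (P y) \<in> orbit_hull F}"
  have "isometry_orbit UNIV norm u \<subseteq> ?D"
  proof
    fix y assume "y \<in> isometry_orbit UNIV norm u"
    then obtain T where T: "isometric_automorphism UNIV norm T" "y = T u"
      by (auto simp: isometry_orbit_def)
    have "patch_op B T f = P y" using u(1) T by (auto simp: patch_op_def P_def)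
    then show "y \<in> ?D"
      using orbit_hull_invariant[OF F patch[OF B T(1)] f(2)] T(1) B sm
      by (simp add: lift_op_abs ae_operator_patch_op)
  qed
  moreover have "convex ?D"
  proof (rule convexI)
    fix x y a b assume *: "x \<in> ?D" "y \<in> ?D" "0 \<le> (a::real)" "0 \<le> b" "a + b = 1"
    have "(\<lambda>t. a *\<^sub>R P x t + b *\<^sub>R P y t) = P (a *\<^sub>R x + b *\<^sub>R y)"
      using * by (auto simp: P_def simp flip: scaleR_add_left)
    then have "abs_L0 (P (a *\<^sub>R x + b *\<^sub>R y)) = a *\<^sub>R abs_L0 (P x) + b *\<^sub>R abs_L0 (P y)"
      using sm by (simp add: abs_L0_scale abs_L0_add strongly_measurable_scaleR)
    then show "a *\<^sub>R x + b *\<^sub>R y \<in> ?D"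
      using convexD[OF convex_orbit_hull[OF F] _ _ *(3-5)] * by simp
  qed
  ultimately have hull: "convex hull (isometry_orbit UNIV norm u) \<subseteq> ?D" by (rule hull_minimal)
  have "v \<in> closure (convex hull (isometry_orbit UNIV norm u))"
    using X u(2) v by (simp add: convex_transitive_def norm_closure_UNIV)
  then have approx: "\<exists>y\<in>?D. norm (y - v) < e" if "e > 0" for e
    using hull that by (auto simp: closure_approachable dist_norm)
  have "abs_L0 (P v) \<in> orbit_hull F"
  proof (rule orbit_hull_closed[OF F simple_mem[OF simple]])
    fix e :: real assume "e > 0"
    then obtain y where y: "y \<in> ?D" "norm (y - v) < e" using approx by blast
    have "simple_function unit_leb (\<lambda>t. P y t - P v t)"
      by (intro simple_function_compose2[where h = minus] simple)
    moreover have "norm (P y t - P v t) \<le> norm (y - v)" for t by (simp add: P_def)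
    ultimately have "N (abs_L0 (P y) - abs_L0 (P v)) \<le> norm (y - v)"
      using sm by (simp add: abs_L0_diff bounded)
    then show "\<exists>H\<in>orbit_hull F. N (H - abs_L0 (P v)) < e" using y by force
  qed
  then show ?thesis by (simp add: P_def)
qed

text \<open>
  On each of the finitely many sets where the pair \<open>(f, g)\<close> is constant, the value of \<open>f\<close> has norm one
  and is replaced by that of \<open>g\<close>; the induction runs over the set \<open>S\<close> of pairs already treated.
\<close>

lemma unimodular_in_orbit_hull:
  assumes X: "convex_transitive (UNIV :: 'a set) norm" and F: "F \<in> V"
    and f: "simple_function unit_leb f" "abs_L0 f \<in> orbit_hull F" "\<And>t. t \<in> {0..1} \<Longrightarrow> norm (f t) = 1"
    and g: "simple_function unit_leb g" "\<And>t. t \<in> {0..1} \<Longrightarrow> norm (g t) \<le> 1"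
  shows "abs_L0 g \<in> orbit_hull F"
proof -
  define fg where "fg t = (f t, g t)" for t
  define h where "h S t = (if t \<in> {0..1} \<and> fg t \<in> S then g t else f t)" for S t
  have fg: "simple_function unit_leb fg"
    unfolding fg_def using f(1) g(1) by (rule simple_function_Pair)
  have h: "simple_function unit_leb (h S)" for S
  proof -
    have "fg -` S \<inter> space unit_leb \<in> sets unit_leb" by (rule simple_functionD(2)[OF fg])
    then have "simple_function unit_leb (\<lambda>t. if t \<in> fg -` S \<inter> space unit_leb then g t else f t)"
      using f(1) g(1) by (intro simple_function_If_set) auto
    moreover have "(\<lambda>t. if t \<in> fg -` S \<inter> space unit_leb then g t else f t) = h S"
      by (auto simp: h_def fun_eq_iff)
    ultimately show ?thesis by simp
  qed
  have "finite S \<Longrightarrow> S \<subseteq> fg ` {0..1} \<Longrightarrow> abs_L0 (h S) \<in> orbit_hull F" for S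
  proof (induction rule: finite_induct)
    case empty
    have "h {} = f" by (auto simp: h_def)
    then show ?case using f by simp
  next
    case (insert p S)
    then obtain t0 where t0: "t0 \<in> {0..1}" "p = fg t0" by auto
    define B where "B = fg -` {p} \<inter> space unit_leb"
    have "abs_L0 (\<lambda>t. if t \<in> B then g t0 else h S t) \<in> orbit_hull F"
    proof (rule patch_value[OF X F h])
      show "abs_L0 (h S) \<in> orbit_hull F" using insert by simp
      show "B \<in> sets unit_leb" unfolding B_def by (rule simple_functionD(2)[OF fg])
      show "h S t = f t0" if "t \<in> B" for t
        using that insert.hyps t0 by (auto simp: B_def h_def fg_def)
      show "norm (f t0) = 1" "norm (g t0) \<le> 1" using t0 f g by auto
    qed
    also have "(\<lambda>t. if t \<in> B then g t0 else h S t) = h (insert p S)"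
      using t0 by (auto simp: B_def h_def fg_def fun_eq_iff)
    finally show ?case .
  qed
  from this[of "fg ` {0..1}"] have "abs_L0 (h (fg ` {0..1})) \<in> orbit_hull F"
    using simple_functionD(1)[OF fg] by simp
  also have "abs_L0 (h (fg ` {0..1})) = abs_L0 g"
  proof (subst abs_L0_eq_iff)
    show "AE t in unit_leb. h (fg ` {0..1}) t = g t"
      using AE_space by eventually_elim (auto simp: h_def)
  qed (intro strongly_measurable_simple h g)+
  finally show ?thesis .
qed

end

section \<open>The spaces of essentially bounded functions\<close>

lemma unit_leb_not_null: "emeasure unit_leb (space unit_leb) = 1"
  by (simp add: emeasure_restrict_space)

lemma Linf_esssup_le:
  assumes "sm f"
  shows "Linf_esssup (abs_L0 f) \<le> ereal c \<longleftrightarrow> (AE t in unit_leb. norm (f t) \<le> c)"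
proof -
  have eq: "Linf_esssup (abs_L0 f) = esssup unit_leb (\<lambda>t. ereal (norm (f t)))"
    using assms by (simp add: Linf_esssup.abs_eq ae_rel_refl)
  have meas: "(\<lambda>t. ereal (norm (f t))) \<in> borel_measurable unit_leb"
    using strongly_measurable_norm[OF assms] by simp
  show ?thesis
  proof
    assume le: "Linf_esssup (abs_L0 f) \<le> ereal c"
    have "AE t in unit_leb. ereal (norm (f t)) \<le> Linf_esssup (abs_L0 f)"
      unfolding eq by (rule esssup_AE)
    then show "AE t in unit_leb. norm (f t) \<le> c"
    proof eventually_elim
      case (elim t)
      then have "ereal (norm (f t)) \<le> ereal c" using le by (rule order_trans)
      then show ?case by simp
    qed
  next
    assume "AE t in unit_leb. norm (f t) \<le> c"
    then show "Linf_esssup (abs_L0 f) \<le> ereal c"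
      unfolding eq by (intro esssup_I meas) simp
  qed
qed

lemma Linf_esssup_nonneg: "0 \<le> Linf_esssup F"
proof -
  obtain f where f: "sm f" "F = abs_L0 f" by (rule L0_cases)
  have "0 = esssup unit_leb (\<lambda>t. 0 :: ereal)"
    using esssup_const[of unit_leb "0 :: ereal"] unit_leb_not_null by simp
  also have "\<dots> \<le> esssup unit_leb (\<lambda>t. ereal (norm (f t)))"
    by (rule esssup_mono) auto
  also have "\<dots> = Linf_esssup F"
    using f by (simp add: Linf_esssup.abs_eq ae_rel_refl)
  finally show ?thesis .
qed

lemma Linf_norm_nonneg: "0 \<le> Linf_norm F"
  unfolding Linf_norm_def using Linf_esssup_nonneg by (rule real_of_ereal_pos)

text \<open>
  This characterization replaces the essential supremum in all that follows.
\<close>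

lemma Linf_norm_le:
  assumes "sm f" "abs_L0 f \<in> Linf_space"
  shows "Linf_norm (abs_L0 f) \<le> c \<longleftrightarrow> (AE t in unit_leb. norm (f t) \<le> c)"
proof -
  have "Linf_esssup (abs_L0 f) = ereal (Linf_norm (abs_L0 f))"
    using assms(2) Linf_esssup_nonneg[of "abs_L0 f"]
    by (cases "Linf_esssup (abs_L0 f)") (auto simp: Linf_space_def Linf_norm_def)
  then show ?thesis using Linf_esssup_le[OF assms(1), of c] by simp
qed

lemma Linf_norm_AE:
  assumes "sm f" "abs_L0 f \<in> Linf_space"
  shows "AE t in unit_leb. norm (f t) \<le> Linf_norm (abs_L0 f)"
  using Linf_norm_le[OF assms, of "Linf_norm (abs_L0 f)"] by simp

lemma Linf_bounded:
  assumes "sm f" "AE t in unit_leb. norm (f t) \<le> c"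
  shows "abs_L0 f \<in> Linf_space" "Linf_norm (abs_L0 f) \<le> c"
proof -
  have "Linf_esssup (abs_L0 f) \<le> ereal c" using assms by (simp add: Linf_esssup_le)
  also have "\<dots> < \<infinity>" by simp
  finally show "abs_L0 f \<in> Linf_space" by (simp add: Linf_space_def)
  then show "Linf_norm (abs_L0 f) \<le> c" using assms by (simp add: Linf_norm_le)
qed

lemma seminormed_subspace_Linf:
  "seminormed_subspace (Linf_space :: 'a::real_normed_vector L0 set) Linf_norm"
proof
  have add: "abs_L0 (\<lambda>t. f t + g t) \<in> Linf_space"
    "Linf_norm (abs_L0 (\<lambda>t. f t + g t)) \<le> Linf_norm (abs_L0 f) + Linf_norm (abs_L0 g)"
    if *: "sm f" "sm g" "abs_L0 f \<in> Linf_space" "abs_L0 g \<in> Linf_space" for f g :: "real \<Rightarrow> 'a"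
  proof -
    have "AE t in unit_leb. norm (f t + g t) \<le> Linf_norm (abs_L0 f) + Linf_norm (abs_L0 g)"
      using Linf_norm_AE[OF *(1,3)] Linf_norm_AE[OF *(2,4)]
      by eventually_elim (rule norm_triangle_le, simp)
    then show "abs_L0 (\<lambda>t. f t + g t) \<in> Linf_space"
      "Linf_norm (abs_L0 (\<lambda>t. f t + g t)) \<le> Linf_norm (abs_L0 f) + Linf_norm (abs_L0 g)"
      using * by (auto intro: Linf_bounded strongly_measurable_add)
  qed
  have scale: "c *\<^sub>R F \<in> Linf_space" "Linf_norm (c *\<^sub>R F) \<le> \<bar>c\<bar> * Linf_norm F"
    if F: "F \<in> Linf_space" for c and F :: "'a L0"
  proof -
    obtain f where f: "sm f" "F = abs_L0 f" by (rule L0_cases)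
    have "AE t in unit_leb. norm (c *\<^sub>R f t) \<le> \<bar>c\<bar> * Linf_norm F"
      using Linf_norm_AE[of f] f F by (auto simp: mult_left_mono elim: eventually_mono)
    from Linf_bounded[OF strongly_measurable_scaleR[OF f(1)] this]
    show "c *\<^sub>R F \<in> Linf_space" "Linf_norm (c *\<^sub>R F) \<le> \<bar>c\<bar> * Linf_norm F"
      using f by (simp_all add: abs_L0_scale)
  qed
  have zero: "(0 :: 'a L0) \<in> Linf_space"
    using Linf_bounded(1)[of "\<lambda>_. 0 :: 'a" 0]
    by (simp add: zero_L0_def strongly_measurable_simple)
  have add': "F + G \<in> Linf_space \<and> Linf_norm (F + G) \<le> Linf_norm F + Linf_norm G"
    if *: "F \<in> Linf_space" "G \<in> Linf_space" for F G :: "'a L0"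
  proof -
    obtain f g where fg: "sm f" "F = abs_L0 f" "sm g" "G = abs_L0 g" by (metis L0_cases)
    then show ?thesis using add[of f g] * by (simp add: abs_L0_add)
  qed
  show "subspace (Linf_space :: 'a L0 set)"
    by (rule subspaceI) (use zero add' scale in auto)
  fix F G :: "'a L0" and c assume F: "F \<in> Linf_space"
  show "Linf_norm (F + G) \<le> Linf_norm F + Linf_norm G" if "G \<in> Linf_space"
    using add' F that by blast
  show "Linf_norm (c *\<^sub>R F) = \<bar>c\<bar> * Linf_norm F"
  proof (cases "c = 0")
    case True
    then show ?thesis using scale(2)[OF F, of 0] Linf_norm_nonneg[of "0 *\<^sub>R F"] by simp
  next
    case False
    have "Linf_norm F = Linf_norm ((1 / c) *\<^sub>R (c *\<^sub>R F))" using False by simp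
    also have "\<dots> \<le> \<bar>1 / c\<bar> * Linf_norm (c *\<^sub>R F)" by (intro scale F)
    finally have "\<bar>c\<bar> * Linf_norm F \<le> Linf_norm (c *\<^sub>R F)"
      using False by (simp add: field_simps)
    then show ?thesis using scale(2)[OF F, of c] by simp
  qed
qed

lemma span_indicators:
  "span {indicator_L0 A x | A x. A \<in> sets unit_leb} = {abs_L0 f | f :: real \<Rightarrow> 'a::real_normed_vector. simple_function unit_leb f}"
  (is "span ?I = ?S")
proof
  show "span ?I \<subseteq> ?S"
  proof (rule span_minimal)
    show "?I \<subseteq> ?S"
    proof clarify
      fix A and x :: 'a assume A: "A \<in> sets unit_leb"
      have "simple_function unit_leb (\<lambda>t. indicat_real A t *\<^sub>R x)"
        using simple_function_indicator[OF A] by (rule simple_function_compose1)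
      then show "\<exists>f. indicator_L0 A x = abs_L0 f \<and> simple_function unit_leb f"
        using A by (intro exI[of _ "\<lambda>t. indicat_real A t *\<^sub>R x"]) (simp add: indicator_L0_def)
    qed
    show "subspace ?S"
    proof (rule subspaceI)
      show "0 \<in> ?S" unfolding zero_L0_def by (auto intro!: exI[of _ "\<lambda>_. 0 :: 'a"])
      fix F G :: "'a L0" and c :: real
      assume "F \<in> ?S"
      then obtain f where f: "F = abs_L0 f" "simple_function unit_leb f" by blast
      have "c *\<^sub>R F = abs_L0 (\<lambda>t. c *\<^sub>R f t)"
        using f by (simp add: abs_L0_scale strongly_measurable_simple)
      then show "c *\<^sub>R F \<in> ?S" using simple_function_compose1[OF f(2)] by blast
      assume "G \<in> ?S"
      then obtain g where g: "G = abs_L0 g" "simple_function unit_leb g" by blast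
      have "F + G = abs_L0 (\<lambda>t. f t + g t)"
        using f g by (simp add: abs_L0_add strongly_measurable_simple)
      then show "F + G \<in> ?S" using simple_function_add[OF f(2) g(2)] by blast
    qed
  qed
  show "?S \<subseteq> span ?I"
  proof clarify
    fix f :: "real \<Rightarrow> 'a" assume f: "simple_function unit_leb f"
    define A where "A x = f -` {x} \<inter> space unit_leb" for x
    have A: "A x \<in> sets unit_leb" for x unfolding A_def using f by (rule simple_functionD(2))
    define e where "e x t = indicat_real (A x) t *\<^sub>R x" for x t
    have "simple_function unit_leb (e x)" for x
      unfolding e_def using simple_function_indicator[OF A] by (rule simple_function_compose1)
    note e_sm = strongly_measurable_simple[OF this]
    have e_span: "abs_L0 (e x) \<in> span ?I" for x
    proof -
      have "abs_L0 (e x) = indicator_L0 (A x) x"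
        using A by (simp add: indicator_L0_def e_def[abs_def])
      also have "\<dots> \<in> span ?I" using A by (auto intro: span_base)
      finally show ?thesis .
    qed
    have sum: "finite R \<Longrightarrow> sm (\<lambda>t. \<Sum>x\<in>R. e x t) \<and> abs_L0 (\<lambda>t. \<Sum>x\<in>R. e x t) \<in> span ?I" for R
    proof (induction rule: finite_induct)
      case empty
      have "abs_L0 (\<lambda>t. 0 :: 'a) = 0" by (simp add: zero_L0_def)
      then show ?case by (simp add: span_zero strongly_measurable_simple)
    next
      case (insert x R)
      have "abs_L0 (e x) + abs_L0 (\<lambda>t. \<Sum>x\<in>R. e x t) \<in> span ?I"
        using insert e_span by (intro span_add) auto
      then show ?case
        using insert e_sm by (simp add: abs_L0_add strongly_measurable_add)
    qed
    have fin: "finite (f ` space unit_leb)" using f by (rule simple_functionD(1))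
    have "f t = (\<Sum>x\<in>f ` space unit_leb. e x t)" if "t \<in> space unit_leb" for t
    proof -
      have "(\<Sum>x\<in>f ` space unit_leb. e x t) = (\<Sum>x\<in>f ` space unit_leb. if x = f t then x else 0)"
        using that by (intro sum.cong) (auto simp: A_def e_def)
      also have "\<dots> = f t" using fin that by simp
      finally show ?thesis ..
    qed
    then have "AE t in unit_leb. f t = (\<Sum>x\<in>f ` space unit_leb. e x t)"
      by (rule AE_I2)
    then have "abs_L0 f = abs_L0 (\<lambda>t. \<Sum>x\<in>f ` space unit_leb. e x t)"
      using f sum[OF fin] by (simp add: abs_L0_eq_iff strongly_measurable_simple)
    then show "abs_L0 f \<in> span ?I" using sum[OF fin] by simp
  qed
qed

lemma simple_function_bounded:
  fixes f :: "real \<Rightarrow> 'a::real_normed_vector"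
  assumes "simple_function unit_leb f"
  obtains c where "0 \<le> c" "\<And>t. t \<in> space unit_leb \<Longrightarrow> norm (f t) \<le> c"
proof -
  have "finite (norm ` f ` space unit_leb)" using simple_functionD(1)[OF assms] by simp
  then obtain c where "\<And>x. x \<in> norm ` f ` space unit_leb \<Longrightarrow> x \<le> c"
    by (meson bdd_above_finite bdd_above_def)
  then show ?thesis by (intro that[of "max 0 c"]) (auto simp: le_max_iff_disj)
qed

lemma simple_in_Linf_space:
  assumes "simple_function unit_leb f"
  shows "abs_L0 f \<in> Linf_space"
proof -
  obtain c where "\<And>t. t \<in> space unit_leb \<Longrightarrow> norm (f t) \<le> c"
    using simple_function_bounded[OF assms] by blast
  then show ?thesis
    using assms by (intro Linf_bounded(1)[of _ c]) (auto simp: strongly_measurable_simple)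
qed

lemma Linf_simple_space_eq:
  "Linf_simple_space = norm_closure Linf_space Linf_norm {abs_L0 f | f. simple_function unit_leb f}"
  unfolding Linf_simple_space_def span_indicators ..

lemma simple_in_Linf_simple_space:
  "simple_function unit_leb f \<Longrightarrow> abs_L0 f \<in> Linf_simple_space"
  unfolding Linf_simple_space_eq
  using seminormed_subspace.subset_norm_closure[OF seminormed_subspace_Linf,
    of "{abs_L0 f | f. simple_function unit_leb f}"] simple_in_Linf_space by blast

lemma seminormed_subspace_Linf_simple:
  "seminormed_subspace (Linf_simple_space :: 'a::real_normed_vector L0 set) Linf_norm"
  unfolding Linf_simple_space_eq
proof (rule seminormed_subspace.seminormed_subspace_norm_closure[OF seminormed_subspace_Linf])
  show "subspace {abs_L0 f | f :: real \<Rightarrow> 'a. simple_function unit_leb f}"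
    unfolding span_indicators[symmetric] by (rule subspace_span)
  show "{abs_L0 f | f :: real \<Rightarrow> 'a. simple_function unit_leb f} \<subseteq> Linf_space"
    using simple_in_Linf_space by blast
qed

text \<open>
  An operator that does not increase essential bounds and has an inverse of the same kind is isometric.
  It preserves the closure of the simple functions as soon as it preserves the simple functions.
\<close>

lemma isometric_automorphism_Linf_simple:
  fixes \<Phi> \<Psi> :: "(real \<Rightarrow> 'a::real_normed_vector) \<Rightarrow> real \<Rightarrow> 'a"
  assumes \<Phi>: "ae_operator \<Phi>" "\<And>f. simple_function unit_leb f \<Longrightarrow> simple_function unit_leb (\<Phi> f)"
      "\<And>f c. (AE t in unit_leb. norm (f t) \<le> c) \<Longrightarrow> AE t in unit_leb. norm (\<Phi> f t) \<le> c"
    and \<Psi>: "ae_operator \<Psi>" "\<And>f. simple_function unit_leb f \<Longrightarrow> simple_function unit_leb (\<Psi> f)"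
      "\<And>f c. (AE t in unit_leb. norm (f t) \<le> c) \<Longrightarrow> AE t in unit_leb. norm (\<Psi> f t) \<le> c"
    and inv: "\<And>f. sm f \<Longrightarrow> AE t in unit_leb. \<Psi> (\<Phi> f) t = f t"
      "\<And>f. sm f \<Longrightarrow> AE t in unit_leb. \<Phi> (\<Psi> f) t = f t"
  shows "isometric_automorphism Linf_simple_space Linf_norm (lift_op \<Phi>)"
proof (rule isometric_automorphism_lift_op[OF \<Phi>(1) \<Psi>(1) inv])
  have contr: "abs_L0 (\<Theta> f) \<in> Linf_space \<and> Linf_norm (abs_L0 (\<Theta> f)) \<le> Linf_norm (abs_L0 f)"
    if \<Theta>: "ae_operator \<Theta>"
        "\<And>f c. (AE t in unit_leb. norm (f t) \<le> c) \<Longrightarrow> AE t in unit_leb. norm (\<Theta> f t) \<le> c"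
      and f: "sm f" "abs_L0 f \<in> Linf_space" for \<Theta> and f :: "real \<Rightarrow> 'a"
  proof -
    have "sm (\<Theta> f)" using \<Theta>(1) f by (simp add: ae_operator_def)
    then show ?thesis using Linf_bounded[OF _ \<Theta>(2)[OF Linf_norm_AE[OF f]]] by blast
  qed
  have mem: "abs_L0 (\<Theta> f) \<in> Linf_simple_space"
    if \<Theta>: "ae_operator \<Theta>" "\<And>f. simple_function unit_leb f \<Longrightarrow> simple_function unit_leb (\<Theta> f)"
        "\<And>f c. (AE t in unit_leb. norm (f t) \<le> c) \<Longrightarrow> AE t in unit_leb. norm (\<Theta> f t) \<le> c"
      and f: "sm f" "abs_L0 f \<in> Linf_simple_space" for \<Theta> and f :: "real \<Rightarrow> 'a"
  proof -
    have sm: "sm g \<Longrightarrow> sm (\<Theta> g)" for g using \<Theta>(1) by (simp add: ae_operator_def)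
    have fL: "abs_L0 f \<in> Linf_space" using f by (simp add: Linf_simple_space_eq norm_closure_def)
    have "\<exists>y\<in>{abs_L0 f | f. simple_function unit_leb f}. Linf_norm (y - abs_L0 (\<Theta> f)) < e"
      if "e > 0" for e
    proof -
      from f(2) that obtain s where s: "simple_function unit_leb s" "Linf_norm (abs_L0 s - abs_L0 f) < e"
        unfolding Linf_simple_space_eq norm_closure_def by blast
      note ss = strongly_measurable_simple[OF s(1)]
      have "abs_L0 s - abs_L0 f \<in> Linf_space"
        using seminormed_subspace.diff_mem[OF seminormed_subspace_Linf] simple_in_Linf_space[OF s(1)] fL
        by blast
      then have "Linf_norm (abs_L0 (\<Theta> (\<lambda>t. s t - f t))) \<le> Linf_norm (abs_L0 s - abs_L0 f)"
        using contr[OF \<Theta>(1,3), of "\<lambda>t. s t - f t"] ss f(1) by (simp add: abs_L0_diff sm_diff)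
      moreover have "\<Theta> (\<lambda>t. s t - f t) = (\<lambda>t. \<Theta> s t - \<Theta> f t)"
        by (intro ext ae_operatorD(5) \<Theta>(1))
      ultimately have "Linf_norm (abs_L0 (\<Theta> s) - abs_L0 (\<Theta> f)) < e"
        using s(2) ss f(1) by (simp add: abs_L0_diff sm)
      then show ?thesis using \<Theta>(2)[OF s(1)] by blast
    qed
    then show ?thesis
      using contr[OF \<Theta>(1,3) f(1) fL] by (simp add: Linf_simple_space_eq norm_closure_def)
  qed
  fix f :: "real \<Rightarrow> 'a" assume f: "sm f" "abs_L0 f \<in> Linf_simple_space"
  show "abs_L0 (\<Phi> f) \<in> Linf_simple_space" "abs_L0 (\<Psi> f) \<in> Linf_simple_space"
    using mem[OF \<Phi> f] mem[OF \<Psi> f] by auto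
  have fL: "abs_L0 f \<in> Linf_space" using f by (simp add: Linf_simple_space_eq norm_closure_def)
  have sm: "sm (\<Phi> f)" "sm (\<Psi> (\<Phi> f))" using \<Phi>(1) \<Psi>(1) f(1) by (simp_all add: ae_operator_def)
  have "abs_L0 (\<Psi> (\<Phi> f)) = abs_L0 f" using sm inv(1)[OF f(1)] f(1) by (simp add: abs_L0_eq_iff)
  then show "Linf_norm (abs_L0 (\<Phi> f)) = Linf_norm (abs_L0 f)"
    using contr[OF \<Phi>(1,3) f(1) fL] contr[OF \<Psi>(1,3) sm(1)] by simp
qed

lemma isometric_automorphism_Linf_compose:
  assumes r: "rearrangement \<tau> \<sigma> w"
  shows "isometric_automorphism Linf_simple_space Linf_norm (lift_op (compose_op (\<lambda>_. 1) \<tau>))"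
proof (rule isometric_automorphism_Linf_simple[where \<Psi> = "compose_op (\<lambda>_. 1) \<sigma>"])
  show "ae_operator (compose_op (\<lambda>_. 1) \<tau>)" "ae_operator (compose_op (\<lambda>_. 1) \<sigma>)"
    by (rule ae_operator_compose_op[OF r] ae_operator_compose_op[OF rearrangement_inverse[OF r]], simp)+
  show "simple_function unit_leb (compose_op (\<lambda>_. 1) \<tau> f)" "simple_function unit_leb (compose_op (\<lambda>_. 1) \<sigma> f)"
    if "simple_function unit_leb f" for f :: "real \<Rightarrow> 'a"
    using simple_function_comp[OF rearrangementD(1)[OF r] that] simple_function_comp[OF rearrangementD(2)[OF r] that]
    by (simp_all add: compose_op_def[abs_def])
  show "AE t in unit_leb. norm (compose_op (\<lambda>_. 1) \<tau> f t) \<le> c" "AE t in unit_leb. norm (compose_op (\<lambda>_. 1) \<sigma> f t) \<le> c"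
    if "AE t in unit_leb. norm (f t) \<le> c" for f :: "real \<Rightarrow> 'a" and c
    using rearrangement_AE[OF r that] rearrangement_AE_inverse[OF r that] by (simp_all add: compose_op_def)
  show "AE t in unit_leb. compose_op (\<lambda>_. 1) \<sigma> (compose_op (\<lambda>_. 1) \<tau> f) t = f t"
    "AE t in unit_leb. compose_op (\<lambda>_. 1) \<tau> (compose_op (\<lambda>_. 1) \<sigma> f) t = f t" for f :: "real \<Rightarrow> 'a"
    using compose_op_inverse[OF r, of "\<lambda>_. 1" f] by simp_all
qed

interpretation Linf: L0_function_space "Linf_simple_space :: 'a::real_normed_vector L0 set" Linf_norm
proof (intro L0_function_space.intro L0_function_space_axioms.intro seminormed_subspace_Linf_simple)
  show "abs_L0 f \<in> Linf_simple_space" if "simple_function unit_leb f" for f :: "real \<Rightarrow> 'a"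
    using that by (rule simple_in_Linf_simple_space)
  show "Linf_norm (abs_L0 f) \<le> c" if "simple_function unit_leb f" "\<And>t. norm (f t) \<le> c"
    for f :: "real \<Rightarrow> 'a" and c
    using that by (intro Linf_bounded) (auto simp: strongly_measurable_simple)
  fix B and T :: "'a \<Rightarrow> 'a"
  assume B: "B \<in> sets unit_leb" and T: "isometric_automorphism UNIV norm T"
  note T' = patch_op_inverse[OF T]
  show "isometric_automorphism Linf_simple_space Linf_norm (lift_op (patch_op B T))"
    by (rule isometric_automorphism_Linf_simple[where \<Psi> = "patch_op B (inv_into UNIV T)"])
      (use B T T' in \<open>auto simp: patch_op_def isometry_UNIV simple_function_patch_op
        intro!: ae_operator_patch_op elim!: eventually_mono\<close>)
qed

section \<open>Convex-transitivity of the simple essentially bounded functions\<close>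

text \<open>
  Give \<open>A\<close> the mass two thirds and its complement the mass one third, and lay out the complement entirely
  to the left, or entirely to the right, of \<open>A\<close>, by shifting it by \<open>\<mp>2\<close>.  The points
  whose image is outside \<open>A\<close> then fill the first or the last third of the interval.
\<close>

lemma rearrangement_concentrating:
  assumes A: "A \<in> sets unit_leb" and pos: "emeasure unit_leb A \<noteq> 0" "emeasure unit_leb ({0..1} - A) \<noteq> 0"
  obtains \<tau> \<sigma> w where "rearrangement \<tau> \<sigma> w"
    "AE u in unit_leb. \<tau> u \<in> A \<or> (if left then u \<le> 1 / 3 else 2 / 3 \<le> u)"
proof -
  obtain S N' where S: "S \<in> sets borel" "N' \<in> null_sets lborel" "S \<subseteq> A" "A \<subseteq> S \<union> N'" "A \<subseteq> {0..1}"
    using A by (rule sets_unit_leb_split)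
  have S_unit: "S \<in> sets unit_leb" using S by (auto simp: sets_restrict_space_iff)
  note [measurable] = S(1) S_unit
  \<comment> \<open>The coordinate \<open>\<psi>\<close> has to be Borel, so \<open>A\<close> is replaced by its Borel part \<open>S\<close>.\<close>
  define C where "C = {0..1} - S"
  have C [measurable]: "C \<in> sets unit_leb" unfolding C_def using S_unit sets.compl_sets[of S unit_leb] by simp
  interpret prob_space unit_leb by (rule prob_spaceI) (rule unit_leb_not_null)
  have "AE t in unit_leb. t \<in> S \<longleftrightarrow> t \<in> A"
    using AE_lborel_unit_leb[OF AE_not_in[OF S(2)]] by eventually_elim (use S in blast)
  then have "emeasure unit_leb S = emeasure unit_leb A" using S_unit A by (rule emeasure_eq_AE)
  then have S_pos: "prob S > 0" using pos by (simp add: emeasure_eq_measure zero_less_measure_iff)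
  have "emeasure unit_leb ({0..1} - A) \<le> emeasure unit_leb C"
    using S(3) C by (intro emeasure_mono) (auto simp: C_def)
  then have "prob ({0..1} - A) \<le> prob C" by (simp add: emeasure_eq_measure)
  moreover have "prob ({0..1} - A) > 0" using pos by (simp add: emeasure_eq_measure zero_less_measure_iff)
  ultimately have C_pos: "prob C > 0" by simp
  define g where "g t = (if t \<in> S then 2 / (3 * prob S) else 1 / (3 * prob C))" for t
  define d :: real where "d = (if left then - 2 else 2)"
  define \<psi> where "\<psi> t = (if t \<in> S then t else t + d)" for t
  have [measurable]: "g \<in> borel_measurable unit_leb" unfolding g_def by measurable
  let ?G = "density unit_leb g"
  have G_S: "emeasure ?G S = ennreal (2 / 3)"
  proof -
    have "emeasure ?G S = (\<integral>\<^sup>+t. ennreal (2 / (3 * prob S)) * indicator S t \<partial>unit_leb)"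
      by (subst emeasure_density) (auto simp: g_def indicator_def intro!: nn_integral_cong)
    also have "\<dots> = ennreal (2 / (3 * prob S)) * ennreal (prob S)"
      by (subst nn_integral_cmult_indicator) (auto simp: emeasure_eq_measure)
    also have "\<dots> = ennreal (2 / 3)" using S_pos by (simp flip: ennreal_mult'')
    finally show ?thesis .
  qed
  have G_C: "emeasure ?G C = ennreal (1 / 3)"
  proof -
    have "emeasure ?G C = (\<integral>\<^sup>+t. ennreal (1 / (3 * prob C)) * indicator C t \<partial>unit_leb)"
      by (subst emeasure_density) (auto simp: g_def C_def indicator_def intro!: nn_integral_cong)
    also have "\<dots> = ennreal (1 / (3 * prob C)) * ennreal (prob C)"
      by (subst nn_integral_cmult_indicator) (auto simp: emeasure_eq_measure)
    also have "\<dots> = ennreal (1 / 3)" using C_pos by (simp flip: ennreal_mult'')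
    finally show ?thesis .
  qed
  have G_total: "emeasure ?G {0..1} = 1"
  proof -
    have "emeasure ?G S + emeasure ?G C = emeasure ?G (S \<union> C)"
      by (rule plus_emeasure) (auto simp: C_def)
    also have "S \<union> C = {0..1}" using S by (auto simp: C_def)
    finally show ?thesis unfolding G_S G_C by (simp flip: ennreal_plus)
  qed
  have g_int: "(\<integral>\<^sup>+t. ennreal (g t) \<partial>unit_leb) = 1"
  proof -
    have "emeasure ?G {0..1} = (\<integral>\<^sup>+t. ennreal (g t) * indicator {0..1} t \<partial>unit_leb)"
      using sets.top[of unit_leb] by (subst emeasure_density) auto
    also have "\<dots> = (\<integral>\<^sup>+t. ennreal (g t) \<partial>unit_leb)"
      by (intro nn_integral_cong) simp
    finally show ?thesis using G_total by simp
  qed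
  interpret G: prob_space ?G by (rule prob_spaceI) (simp add: G_total)
  have g_pos: "AE t in unit_leb. 0 < g t" using S_pos C_pos by (simp add: g_def)
  have \<psi>_meas: "\<psi> \<in> borel_measurable borel" unfolding \<psi>_def by measurable
  define \<phi> :: "real \<Rightarrow> real" where "\<phi> x = (if x \<in> {0..1} then x else x - d)" for x
  have \<phi>_meas: "\<phi> \<in> borel_measurable borel" unfolding \<phi>_def by measurable
  have inv: "\<phi> (\<psi> t) = t" if "t \<in> {0..1}" for t
    using that by (auto simp: \<phi>_def \<psi>_def d_def)
  obtain \<tau> where r: "rearrangement \<tau> (\<lambda>t. measure ?G {s \<in> {0..1}. \<psi> s \<le> \<psi> t}) (\<lambda>u. 1 / g (\<tau> u))"
    using rearrangement_exists[OF \<open>g \<in> borel_measurable unit_leb\<close> g_pos g_int \<psi>_meas \<phi>_meas inv] by blast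
  have le_meas: "{s \<in> {0..1}. \<psi> s \<le> x} \<in> sets ?G" for x
    using measurable_sets[OF borel_unit_leb_measurable[OF \<psi>_meas], of "{..x}"]
    by (auto simp: vimage_def Int_def conj_commute)
  have "AE u in unit_leb. \<tau> u \<in> {0..1}"
    using AE_space by eventually_elim (use measurable_space[OF rearrangementD(1)[OF r]] in simp)
  with rearrangementD(5)[OF r]
  have "AE u in unit_leb. \<tau> u \<in> A \<or> (if left then u \<le> 1 / 3 else 2 / 3 \<le> u)"
  proof eventually_elim
    case (elim u)
    show ?case
    proof (cases "\<tau> u \<in> S")
      case True
      then show ?thesis using S(3) by blast
    next
      case False
      show ?thesis
      proof (cases left)
        case True
        then have "{s \<in> {0..1}. \<psi> s \<le> \<psi> (\<tau> u)} \<subseteq> C"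
          using False elim by (auto simp: \<psi>_def d_def C_def)
        then have "u \<le> measure ?G C"
          using elim(1) G.finite_measure_mono[of "{s \<in> {0..1}. \<psi> s \<le> \<psi> (\<tau> u)}" C] C by simp
        also have "measure ?G C = 1 / 3" using G_C by (simp add: G.emeasure_eq_measure)
        finally show ?thesis using True by simp
      next
        case right: False
        then have "S \<subseteq> {s \<in> {0..1}. \<psi> s \<le> \<psi> (\<tau> u)}"
          using False elim S by (auto simp: \<psi>_def d_def)
        then have "measure ?G S \<le> measure ?G {s \<in> {0..1}. \<psi> s \<le> \<psi> (\<tau> u)}"
          by (rule G.finite_measure_mono[OF _ le_meas])
        also have "\<dots> = u" by (rule elim(1))
        finally show ?thesis using right G_S by (simp add: G.emeasure_eq_measure)
      qed
    qed
  qed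
  with r show ?thesis by (rule that)
qed

text \<open>
  A simple function has finitely many values.  If those of norm one were taken on null sets only, the
  remaining ones would bound the essential supremum by a number below one.
\<close>

lemma simple_Linf_norm_attained:
  fixes f :: "real \<Rightarrow> 'a::real_normed_vector"
  assumes f: "simple_function unit_leb f" and N: "Linf_norm (abs_L0 f) = 1"
  obtains x where "norm x = 1" "emeasure unit_leb (f -` {x} \<inter> {0..1}) \<noteq> 0"
proof -
  have sets: "f -` {x} \<inter> {0..1} \<in> sets unit_leb" for x
    using simple_functionD(2)[OF f, of "{x}"] by simp
  have sm: "sm f" using f by (rule strongly_measurable_simple)
  note L = simple_in_Linf_space[OF f]
  have le1: "AE t in unit_leb. norm (f t) \<le> 1" using Linf_norm_AE[OF sm L] N by simp
  have "\<exists>x. norm x = 1 \<and> emeasure unit_leb (f -` {x} \<inter> {0..1}) \<noteq> 0"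
  proof (rule ccontr)
    assume "\<not> ?thesis"
    then have null: "f -` {x} \<inter> {0..1} \<in> null_sets unit_leb" if "norm x = 1" for x
      using that sets by (auto simp: null_sets_def)
    let ?R = "f ` {0..1}"
    have fin: "finite ?R" using simple_functionD(1)[OF f] by simp
    define c where "c = Max (insert 0 {norm x | x. x \<in> ?R \<and> norm x < 1})"
    have fin': "finite (insert 0 {norm x | x. x \<in> ?R \<and> norm x < 1})" using fin by simp
    have "c < 1" unfolding c_def using fin' by (subst Max_less_iff) auto
    have "AE t in unit_leb. \<forall>x\<in>{x \<in> ?R. norm x = 1}. t \<notin> f -` {x} \<inter> {0..1}"
    proof (rule AE_finite_allI)
      show "finite {x \<in> ?R. norm x = 1}" using fin by simp
      show "AE t in unit_leb. t \<notin> f -` {x} \<inter> {0..1}" if "x \<in> {x \<in> ?R. norm x = 1}" for x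
        using that by (intro AE_not_in null) simp
    qed
    with le1 AE_space have "AE t in unit_leb. norm (f t) \<le> c"
    proof eventually_elim
      case (elim t)
      then have "norm (f t) < 1" by force
      then show ?case unfolding c_def using fin' elim by (intro Max_ge) auto
    qed
    then have "Linf_norm (abs_L0 f) \<le> c" using Linf_norm_le[OF sm L] by simp
    then show False using N \<open>c < 1\<close> by simp
  qed
  then show ?thesis using that by blast
qed

text \<open>
  Compose with the two rearrangements that concentrate on the set where the value \<open>x\<close> is taken, and
  average.  Almost everywhere one of the two summands is exactly \<open>x\<close>, which halves the distance to \<open>x\<close>;
  on the middle third both are \<open>x\<close>, which allows the step to be repeated.
\<close>

lemma constant_in_orbit_hull:
  fixes f :: "real \<Rightarrow> 'a::real_normed_vector"
  assumes f: "simple_function unit_leb f" and x: "norm x = 1"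
    and le1: "AE t in unit_leb. norm (f t) \<le> 1" and A: "emeasure unit_leb (f -` {x} \<inter> {0..1}) \<noteq> 0"
  shows "abs_L0 (\<lambda>_. x) \<in> Linf.orbit_hull (abs_L0 f)"
proof -
  let ?K = "Linf.orbit_hull (abs_L0 f)"
  note F = simple_in_Linf_simple_space[OF f]
  \<comment> \<open>The power of two in the bound counts the averaging steps.\<close>
  have step: "\<exists>h. simple_function unit_leb h \<and> abs_L0 h \<in> ?K \<and>
      emeasure unit_leb (h -` {x} \<inter> {0..1}) \<noteq> 0 \<and> (AE t in unit_leb. norm (h t - x) \<le> 2 / 2 ^ n)" for n
  proof (induction n)
    case 0
    have "AE t in unit_leb. norm (f t - x) \<le> 2"
      using le1 by eventually_elim (use x norm_triangle_ineq4[of _ x] in \<open>fastforce intro: order_trans\<close>)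
    then show ?case using f A Linf.self_in_orbit_hull[OF F] by auto
  next
    case (Suc n)
    then obtain h where h: "simple_function unit_leb h" "abs_L0 h \<in> ?K"
      "emeasure unit_leb (h -` {x} \<inter> {0..1}) \<noteq> 0" "AE t in unit_leb. norm (h t - x) \<le> 2 / 2 ^ n"
      by blast
    let ?A = "h -` {x} \<inter> {0..1}"
    have A: "?A \<in> sets unit_leb" using simple_functionD(2)[OF h(1), of "{x}"] by simp
    show ?case
    proof (cases "emeasure unit_leb ({0..1} - ?A) = 0")
      \<comment> \<open>There is nothing to concentrate, and \<open>h\<close> already is the constant function.\<close>
      case True
      moreover have "{0..1} - ?A \<in> sets unit_leb" using sets.compl_sets[OF A] by simp
      ultimately have "{0..1} - ?A \<in> null_sets unit_leb" by blast
      from AE_not_in[OF this] AE_space[of unit_leb]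
      have "AE t in unit_leb. norm (h t - x) \<le> 2 / 2 ^ Suc n" by eventually_elim auto
      with h show ?thesis by blast
    next
      case False
      obtain \<tau>1 \<sigma>1 w1 where r1: "rearrangement \<tau>1 \<sigma>1 w1"
        "AE u in unit_leb. \<tau>1 u \<in> ?A \<or> u \<le> 1 / 3"
        using rearrangement_concentrating[OF A h(3) False, of True] by auto
      obtain \<tau>2 \<sigma>2 w2 where r2: "rearrangement \<tau>2 \<sigma>2 w2"
        "AE u in unit_leb. \<tau>2 u \<in> ?A \<or> 2 / 3 \<le> u"
        using rearrangement_concentrating[OF A h(3) False, of False] by auto
      define h' where "h' t = (1/2) *\<^sub>R h (\<tau>1 t) + (1/2) *\<^sub>R h (\<tau>2 t)" for t
      have comp: "simple_function unit_leb (\<lambda>t. h (\<tau> t)) \<and> abs_L0 (\<lambda>t. h (\<tau> t)) \<in> ?K"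
        if r: "rearrangement \<tau> \<sigma> w" for \<tau> \<sigma> w
      proof -
        have "lift_op (compose_op (\<lambda>_. 1) \<tau>) (abs_L0 h) = abs_L0 (\<lambda>t. h (\<tau> t))"
          using strongly_measurable_simple[OF h(1)]
          by (subst lift_op_abs[OF ae_operator_compose_op[OF r]]) (simp_all add: compose_op_def[abs_def])
        then show ?thesis
          using Linf.orbit_hull_invariant[OF F isometric_automorphism_Linf_compose[OF r] h(2)]
            simple_function_comp[OF rearrangementD(1)[OF r] h(1)] by simp
      qed
      note c1 = comp[OF r1(1)] and c2 = comp[OF r2(1)]
      have h'_simple: "simple_function unit_leb h'"
        unfolding h'_def using c1 c2
        by (intro simple_function_compose2[where h = "\<lambda>a b. (1/2) *\<^sub>R a + (1/2) *\<^sub>R b"]) auto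
      have "abs_L0 h' = (1/2) *\<^sub>R abs_L0 (\<lambda>t. h (\<tau>1 t)) + (1/2) *\<^sub>R abs_L0 (\<lambda>t. h (\<tau>2 t))"
        using c1 c2 unfolding h'_def
        by (simp add: abs_L0_scale abs_L0_add strongly_measurable_scaleR strongly_measurable_simple)
      also have "\<dots> \<in> ?K"
        using c1 c2 by (intro convexD[OF Linf.convex_orbit_hull[OF F]]) auto
      finally have h'_K: "abs_L0 h' \<in> ?K" .
      have h'_x: "h' t - x = (1/2) *\<^sub>R (h (\<tau>1 t) - x) + (1/2) *\<^sub>R (h (\<tau>2 t) - x)" for t
        by (simp add: h'_def algebra_simps flip: scaleR_add_left)
      have "AE t in unit_leb. norm (h' t - x) \<le> 2 / 2 ^ Suc n"
        using rearrangement_AE[OF r1(1) h(4)] rearrangement_AE[OF r2(1) h(4)] r1(2) r2(2)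
      proof eventually_elim
        case (elim t)
        then have "h (\<tau>1 t) = x \<or> h (\<tau>2 t) = x" by auto
        then show ?case using elim by (auto simp: h'_x)
      qed
      moreover have "emeasure unit_leb (h' -` {x} \<inter> {0..1}) \<noteq> 0"
      proof
        assume "emeasure unit_leb (h' -` {x} \<inter> {0..1}) = 0"
        then have "h' -` {x} \<inter> {0..1} \<in> null_sets unit_leb"
          using simple_functionD(2)[OF h'_simple, of "{x}"] by (auto simp: null_sets_def)
        from AE_not_in[OF this] r1(2) r2(2) AE_space[of unit_leb]
        have "AE t in unit_leb. t \<notin> {1/3<..<2/3}"
          by eventually_elim (auto simp: h'_x simp flip: right_minus_eq[of "h' _"])
        then have "emeasure unit_leb {1/3<..<2/3} = 0"
          by (subst AE_iff_measurable[symmetric, where P = "\<lambda>t. t \<notin> {1/3<..<2/3}"])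
            (auto simp: sets_restrict_space_iff)
        moreover have "emeasure unit_leb {1/3<..<2/3} = emeasure lebesgue {1/3<..<2/3::real}"
          by (rule emeasure_restrict_space) auto
        moreover have "\<dots> = ennreal (1 / 3)" by simp
        ultimately show False by simp
      qed
      ultimately show ?thesis using h'_simple h'_K by blast
    qed
  qed
  show ?thesis
  proof (rule Linf.orbit_hull_closed[OF F])
    show "abs_L0 (\<lambda>_. x) \<in> Linf_simple_space" by (intro simple_in_Linf_simple_space) simp
    fix e :: real assume e: "e > 0"
    obtain n where n: "2 / 2 ^ n < e"
      using real_arch_pow_inv[of "e / 2" "1 / 2"] e by (auto simp: power_divide field_simps)
    obtain h where h: "simple_function unit_leb h" "abs_L0 h \<in> ?K"
      "AE t in unit_leb. norm (h t - x) \<le> 2 / 2 ^ n" using step by blast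
    have sm: "sm h" "sm (\<lambda>_. x)" using h by (auto intro: strongly_measurable_simple)
    have "Linf_norm (abs_L0 h - abs_L0 (\<lambda>_. x)) \<le> 2 / 2 ^ n"
      using sm h(3) by (simp add: abs_L0_diff Linf_bounded sm_diff)
    then show "\<exists>H\<in>?K. Linf_norm (H - abs_L0 (\<lambda>_. x)) < e" using h n by force
  qed
qed

lemma convex_transitive_Linf_simple:
  assumes X: "convex_transitive (UNIV :: 'a::real_normed_vector set) norm"
  shows "convex_transitive (Linf_simple_space :: 'a L0 set) Linf_norm"
proof (rule Linf.convex_transitiveI)
  let ?D = "{abs_L0 f | f :: real \<Rightarrow> 'a. simple_function unit_leb f}"
  show "?D \<subseteq> Linf_simple_space" using simple_in_Linf_simple_space by blast
  show "c *\<^sub>R F \<in> ?D" if F: "F \<in> ?D" for F c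
  proof -
    obtain f where f: "F = abs_L0 f" "simple_function unit_leb f" using F by blast
    then have "c *\<^sub>R F = abs_L0 (\<lambda>t. c *\<^sub>R f t)" by (simp add: abs_L0_scale strongly_measurable_simple)
    then show ?thesis using simple_function_compose1[OF f(2)] by blast
  qed
  show "\<exists>G\<in>?D. Linf_norm (G - F) < e" if "F \<in> Linf_simple_space" "0 < e" for F :: "'a L0" and e
    using that unfolding Linf_simple_space_eq norm_closure_def by blast
  show "G \<in> Linf.orbit_hull F" if FG: "F \<in> ?D" "G \<in> ?D" "Linf_norm F = 1" "Linf_norm G = 1" for F G
  proof -
    obtain f g where f: "F = abs_L0 f" "simple_function unit_leb f"
      and g: "G = abs_L0 g" "simple_function unit_leb g" using FG by blast
    have le1: "AE t in unit_leb. norm (h t) \<le> 1"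
      if "simple_function unit_leb h" "Linf_norm (abs_L0 h) = 1" for h :: "real \<Rightarrow> 'a"
      using Linf_norm_AE[OF strongly_measurable_simple simple_in_Linf_space, of h] that by simp
    obtain x where x: "norm x = 1" "emeasure unit_leb (f -` {x} \<inter> {0..1}) \<noteq> 0"
      using simple_Linf_norm_attained[OF f(2)] f FG by blast
    define g' where "g' t = (if norm (g t) \<le> 1 then g t else 0)" for t
    have g': "simple_function unit_leb g'" unfolding g'_def using simple_function_compose1[OF g(2)] .
    have "abs_L0 g' \<in> Linf.orbit_hull F"
    proof (rule Linf.unimodular_in_orbit_hull[OF X])
      show "F \<in> Linf_simple_space" using f simple_in_Linf_simple_space by blast
      show "abs_L0 (\<lambda>_. x) \<in> Linf.orbit_hull F"
        using constant_in_orbit_hull[OF f(2) x(1) le1 x(2)] f FG by simp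
    qed (use x g' in \<open>auto simp: g'_def\<close>)
    also have "abs_L0 g' = G"
      using le1[OF g(2)] g g' FG
      by (auto simp: abs_L0_eq_iff strongly_measurable_simple g'_def elim: eventually_mono)
    finally show ?thesis .
  qed
qed

section \<open>Bochner spaces with finite exponent\<close>

lemma powr_convex_combination:
  fixes x y u v p :: real
  assumes "1 \<le> p" "0 \<le> x" "0 \<le> y" "0 \<le> u" "0 \<le> v" "u + v = 1"
  shows "(u * x + v * y) powr p \<le> u * x powr p + v * y powr p"
proof -
  have scale: "(c * z) powr p \<le> c * z powr p" if "0 \<le> c" "c \<le> 1" "0 \<le> z" for c z :: real
  proof -
    have "c powr p \<le> c" using powr_mono'[of 1 p c] that assms(1) by (cases "c = 0") auto
    then show ?thesis using that by (simp add: powr_mult mult_right_mono)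
  qed
  show ?thesis
  proof (cases "x = 0 \<or> y = 0")
    case True
    then show ?thesis using scale[of u x] scale[of v y] assms by auto
  next
    case False
    then have "(\<lambda>x. x powr p) ((1 - v) *\<^sub>R x + v *\<^sub>R y) \<le> (1 - v) * x powr p + v * y powr p"
      using assms by (intro convex_onD[OF powr_convex]) auto
    moreover have "1 - v = u" using assms by simp
    ultimately show ?thesis by simp
  qed
qed

lemma Lp_nn_integral_abs:
  "sm f \<Longrightarrow> Lp_nn_integral p (abs_L0 f) = (\<integral>\<^sup>+t. ennreal (norm (f t) powr p) \<partial>unit_leb)"
  by (simp add: Lp_nn_integral.abs_eq ae_rel_refl)

text \<open>
  Minkowski's inequality: \<open>f + g\<close> is \<open>a + b\<close> times a convex combination of \<open>f / a\<close> and \<open>g / b\<close>, and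
  \<open>x \<mapsto> x\<^sup>p\<close> is convex.  Bounds \<open>a\<close> and \<open>b\<close> in place of the norms allow division when a norm is zero.
\<close>

lemma Lp_nn_integral_add:
  fixes f g :: "real \<Rightarrow> 'a::real_normed_vector"
  assumes p: "1 \<le> p" and f: "sm f" "Lp_nn_integral p (abs_L0 f) \<le> ennreal (a powr p)"
    and g: "sm g" "Lp_nn_integral p (abs_L0 g) \<le> ennreal (b powr p)" and ab: "0 < a" "0 < b"
  shows "Lp_nn_integral p (abs_L0 (\<lambda>t. f t + g t)) \<le> ennreal ((a + b) powr p)"
proof -
  note [measurable] = strongly_measurable_norm[OF f(1)] strongly_measurable_norm[OF g(1)]
  \<comment> \<open>The coefficients of \<open>\<parallel>f\<parallel>\<^sup>p\<close> and \<open>\<parallel>g\<parallel>\<^sup>p\<close> that convexity produces; \<open>A a\<^sup>p + B b\<^sup>p = (a + b)\<^sup>p\<close>.\<close>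
  define A where "A = (a + b) powr p * (a / (a + b)) / a powr p"
  define B where "B = (a + b) powr p * (b / (a + b)) / b powr p"
  have AB: "0 \<le> A" "0 \<le> B" using ab by (auto simp: A_def B_def)
  have "norm (f t + g t) powr p \<le> A * norm (f t) powr p + B * norm (g t) powr p" for t
  proof -
    have "a / (a + b) + b / (a + b) = (a + b) / (a + b)" by (simp only: add_divide_distrib)
    then have sum1: "a / (a + b) + b / (a + b) = 1" using ab by simp
    have "norm (f t + g t) \<le> norm (f t) + norm (g t)" by (rule norm_triangle_ineq)
    also have "\<dots> = (a + b) * (norm (f t) / (a + b) + norm (g t) / (a + b))"
      using ab by (simp flip: add_divide_distrib)
    also have "\<dots> = (a + b) * (a / (a + b) * (norm (f t) / a) + b / (a + b) * (norm (g t) / b))"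
      using ab by simp
    finally have "norm (f t + g t) powr p \<le>
        ((a + b) * (a / (a + b) * (norm (f t) / a) + b / (a + b) * (norm (g t) / b))) powr p"
      using p by (intro powr_mono2) auto
    also have "\<dots> = (a + b) powr p * (a / (a + b) * (norm (f t) / a) + b / (a + b) * (norm (g t) / b)) powr p"
      by (rule powr_mult)
    also have "\<dots> \<le> (a + b) powr p * (a / (a + b) * (norm (f t) / a) powr p + b / (a + b) * (norm (g t) / b) powr p)"
      using p ab sum1 by (intro mult_left_mono powr_convex_combination) auto
    also have "\<dots> = A * norm (f t) powr p + B * norm (g t) powr p"
      using ab by (simp add: A_def B_def powr_divide distrib_left)
    finally show ?thesis .
  qed
  then have "Lp_nn_integral p (abs_L0 (\<lambda>t. f t + g t)) \<le>
      (\<integral>\<^sup>+t. ennreal A * ennreal (norm (f t) powr p) + ennreal B * ennreal (norm (g t) powr p) \<partial>unit_leb)"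
    using AB f(1) g(1)
    by (auto simp: Lp_nn_integral_abs strongly_measurable_add intro!: nn_integral_mono
      simp flip: ennreal_mult ennreal_plus)
  also have "\<dots> = ennreal A * Lp_nn_integral p (abs_L0 f) + ennreal B * Lp_nn_integral p (abs_L0 g)"
    using f(1) g(1) by (simp add: nn_integral_add nn_integral_cmult Lp_nn_integral_abs)
  also have "\<dots> \<le> ennreal A * ennreal (a powr p) + ennreal B * ennreal (b powr p)"
    using f(2) g(2) by (intro add_mono mult_left_mono) auto
  also have "\<dots> = ennreal (A * a powr p + B * b powr p)"
    using AB by (simp add: ennreal_mult ennreal_plus)
  also have "A * a powr p + B * b powr p = (a + b) powr p * ((a + b) / (a + b))"
    using ab by (simp add: A_def B_def distrib_left add_divide_distrib del: divide_self_if)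
  also have "\<dots> = (a + b) powr p" using ab by simp
  finally show ?thesis .
qed

lemma Lp_norm_nonneg: "0 \<le> Lp_norm p F"
  by (simp add: Lp_norm_def)

lemma Lp_norm_le:
  assumes p: "1 \<le> p" and F: "F \<in> Lp_space p" and c: "0 \<le> c"
  shows "Lp_norm p F \<le> c \<longleftrightarrow> Lp_nn_integral p F \<le> ennreal (c powr p)"
proof -
  obtain r where r: "0 \<le> r" "Lp_nn_integral p F = ennreal r"
    using F by (cases "Lp_nn_integral p F") (auto simp: Lp_space_def)
  have "r powr (1 / p) \<le> c \<longleftrightarrow> r \<le> c powr p"
  proof
    assume "r powr (1 / p) \<le> c"
    then have "(r powr (1 / p)) powr p \<le> c powr p" using p by (intro powr_mono2) auto
    then show "r \<le> c powr p" using p r by (simp add: powr_powr)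
  next
    assume "r \<le> c powr p"
    then have "r powr (1 / p) \<le> (c powr p) powr (1 / p)" using p r by (intro powr_mono2) auto
    then show "r powr (1 / p) \<le> c" using p c by (simp add: powr_powr)
  qed
  then show ?thesis using r by (simp add: Lp_norm_def)
qed

lemma Lp_normI:
  assumes "1 \<le> p" "0 \<le> c" "Lp_nn_integral p F \<le> ennreal (c powr p)"
  shows "F \<in> Lp_space p" "Lp_norm p F \<le> c"
proof -
  have "Lp_nn_integral p F < \<infinity>" using assms(3) by (rule order_le_less_trans) simp
  then show "F \<in> Lp_space p" by (simp add: Lp_space_def)
  then show "Lp_norm p F \<le> c" using assms Lp_norm_le by blast
qed

lemma Lp_nn_integral_scale:
  assumes "sm f"
  shows "Lp_nn_integral p (abs_L0 (\<lambda>t. c *\<^sub>R f t)) = ennreal (\<bar>c\<bar> powr p) * Lp_nn_integral p (abs_L0 f)"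
proof -
  note [measurable] = strongly_measurable_norm[OF assms]
  show ?thesis
    using assms by (simp add: Lp_nn_integral_abs strongly_measurable_scaleR powr_mult ennreal_mult
      flip: nn_integral_cmult)
qed

lemma seminormed_subspace_Lp:
  assumes p: "1 \<le> p"
  shows "seminormed_subspace (Lp_space p :: 'a::real_normed_vector L0 set) (Lp_norm p)"
proof
  have add: "F + G \<in> Lp_space p \<and> Lp_norm p (F + G) \<le> Lp_norm p F + Lp_norm p G"
    if FG: "F \<in> Lp_space p" "G \<in> Lp_space p" for F G :: "'a L0"
  proof -
    obtain f g where fg: "sm f" "F = abs_L0 f" "sm g" "G = abs_L0 g" by (metis L0_cases)
    have le: "Lp_nn_integral p (F + G) \<le> ennreal ((Lp_norm p F + e + (Lp_norm p G + e)) powr p)"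
      if "0 < e" for e
    proof -
      have "Lp_norm p H + e > 0" for H :: "'a L0" using Lp_norm_nonneg[of p H] that by simp
      moreover have "Lp_nn_integral p H \<le> ennreal ((Lp_norm p H + e) powr p)" if "H \<in> Lp_space p" for H :: "'a L0"
        using Lp_norm_le[OF p that, of "Lp_norm p H + e"] \<open>0 < e\<close> Lp_norm_nonneg[of p H] by simp
      ultimately show ?thesis
        using FG fg unfolding fg(2,4) abs_L0_add[OF fg(1,3)]
        by (intro Lp_nn_integral_add p) auto
    qed
    have mem: "F + G \<in> Lp_space p"
      using Lp_normI(1)[OF p _ le[of 1]] Lp_norm_nonneg[of p F] Lp_norm_nonneg[of p G] by simp
    moreover have "Lp_norm p (F + G) \<le> Lp_norm p F + Lp_norm p G"
    proof (rule field_le_epsilon)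
      fix e :: real assume "0 < e"
      then show "Lp_norm p (F + G) \<le> Lp_norm p F + Lp_norm p G + e"
        using Lp_normI(2)[OF p _ le[of "e / 2"]] Lp_norm_nonneg[of p F] Lp_norm_nonneg[of p G] by simp
    qed
    ultimately show ?thesis by simp
  qed
  have scale: "c *\<^sub>R F \<in> Lp_space p \<and> Lp_norm p (c *\<^sub>R F) = \<bar>c\<bar> * Lp_norm p F"
    if "F \<in> Lp_space p" for F :: "'a L0" and c
  proof -
    obtain f where f: "sm f" "F = abs_L0 f" by (rule L0_cases)
    have eq: "Lp_nn_integral p (c *\<^sub>R F) = ennreal (\<bar>c\<bar> powr p) * Lp_nn_integral p F"
      using f by (simp add: abs_L0_scale Lp_nn_integral_scale)
    have "Lp_norm p (c *\<^sub>R F) = \<bar>c\<bar> * Lp_norm p F"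
      using p by (simp add: Lp_norm_def eq enn2real_mult powr_mult powr_powr)
    then show ?thesis using that by (auto simp: Lp_space_def eq ennreal_mult_less_top)
  qed
  have zero: "(0 :: 'a L0) \<in> Lp_space p"
    using p by (simp add: Lp_space_def zero_L0_def Lp_nn_integral_abs strongly_measurable_simple)
  show "subspace (Lp_space p :: 'a L0 set)"
    by (rule subspaceI) (use zero add scale in auto)
  show "Lp_norm p (F + G) \<le> Lp_norm p F + Lp_norm p G" if "F \<in> Lp_space p" "G \<in> Lp_space p" for F G :: "'a L0"
    using add that by blast
  show "Lp_norm p (c *\<^sub>R F) = \<bar>c\<bar> * Lp_norm p F" if "F \<in> Lp_space p" for F :: "'a L0" and c
    using scale that by blast
qed

lemma isometric_automorphism_Lp:
  fixes \<Phi> \<Psi> :: "(real \<Rightarrow> 'a::real_normed_vector) \<Rightarrow> real \<Rightarrow> 'a"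
  assumes \<Phi>: "ae_operator \<Phi>" and \<Psi>: "ae_operator \<Psi>"
    and inv: "\<And>f. sm f \<Longrightarrow> AE t in unit_leb. \<Psi> (\<Phi> f) t = f t"
      "\<And>f. sm f \<Longrightarrow> AE t in unit_leb. \<Phi> (\<Psi> f) t = f t"
    and int: "\<And>f. sm f \<Longrightarrow> Lp_nn_integral p (abs_L0 (\<Phi> f)) = Lp_nn_integral p (abs_L0 f)"
  shows "isometric_automorphism (Lp_space p) (Lp_norm p) (lift_op \<Phi>)"
proof (rule isometric_automorphism_lift_op[OF \<Phi> \<Psi> inv])
  fix f :: "real \<Rightarrow> 'a" assume f: "sm f" "abs_L0 f \<in> Lp_space p"
  show "abs_L0 (\<Phi> f) \<in> Lp_space p" "Lp_norm p (abs_L0 (\<Phi> f)) = Lp_norm p (abs_L0 f)"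
    using int[OF f(1)] f(2) by (simp_all add: Lp_space_def Lp_norm_def)
  have "sm (\<Psi> f)" "sm (\<Phi> (\<Psi> f))" using f \<Phi> \<Psi> by (simp_all add: ae_operatorD(1))
  then have "abs_L0 (\<Phi> (\<Psi> f)) = abs_L0 f" using f inv by (simp add: abs_L0_eq_iff)
  then show "abs_L0 (\<Psi> f) \<in> Lp_space p"
    using int[OF \<open>sm (\<Psi> f)\<close>] f(2) by (simp add: Lp_space_def)
qed

lemma Lp_nn_integral_bounded:
  assumes p: "1 \<le> p" and f: "simple_function unit_leb f" "\<And>t. t \<in> space unit_leb \<Longrightarrow> norm (f t) \<le> c"
  shows "Lp_nn_integral p (abs_L0 f) \<le> ennreal (c powr p)"
proof -
  have "Lp_nn_integral p (abs_L0 f) = (\<integral>\<^sup>+t. ennreal (norm (f t) powr p) \<partial>unit_leb)"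
    using f by (simp add: Lp_nn_integral_abs strongly_measurable_simple)
  also have "\<dots> \<le> (\<integral>\<^sup>+t. ennreal (c powr p) \<partial>unit_leb)"
    using p f by (intro nn_integral_mono ennreal_leI powr_mono2) auto
  also have "\<dots> = ennreal (c powr p)" using unit_leb_not_null by simp
  finally show ?thesis .
qed

lemma simple_in_Lp_space:
  assumes p: "1 \<le> p" and f: "simple_function unit_leb f"
  shows "abs_L0 f \<in> Lp_space p"
proof -
  obtain c where "0 \<le> c" "\<And>t. t \<in> space unit_leb \<Longrightarrow> norm (f t) \<le> c"
    using simple_function_bounded[OF f] by blast
  then show ?thesis using Lp_normI(1)[OF p _ Lp_nn_integral_bounded[OF p f]] by blast
qed

lemma L0_function_space_Lp:
  assumes p: "1 \<le> p"
  shows "L0_function_space (Lp_space p :: 'a::real_normed_vector L0 set) (Lp_norm p)"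
proof (intro L0_function_space.intro L0_function_space_axioms.intro seminormed_subspace_Lp p)
  show "abs_L0 f \<in> Lp_space p" if "simple_function unit_leb f" for f :: "real \<Rightarrow> 'a"
    using p that by (rule simple_in_Lp_space)
  show "Lp_norm p (abs_L0 f) \<le> c" if f: "simple_function unit_leb f" "\<And>t. norm (f t) \<le> c"
    for f :: "real \<Rightarrow> 'a" and c
  proof (rule Lp_normI(2)[OF p])
    show "0 \<le> c" using norm_ge_zero f(2) by (rule order_trans)
    show "Lp_nn_integral p (abs_L0 f) \<le> ennreal (c powr p)" using p f by (rule Lp_nn_integral_bounded)
  qed
  fix B and T :: "'a \<Rightarrow> 'a"
  assume B: "B \<in> sets unit_leb" and T: "isometric_automorphism UNIV norm T"
  note T' = patch_op_inverse[OF T]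
  show "isometric_automorphism (Lp_space p) (Lp_norm p) (lift_op (patch_op B T))"
  proof (rule isometric_automorphism_Lp[where \<Psi> = "patch_op B (inv_into UNIV T)"])
    show "Lp_nn_integral p (abs_L0 (patch_op B T f)) = Lp_nn_integral p (abs_L0 f)" if f: "sm f" for f
    proof -
      have "norm (patch_op B T f t) = norm (f t)" for t by (simp add: patch_op_def isometry_UNIV[OF T])
      then show ?thesis
        using f by (simp add: Lp_nn_integral_abs ae_operatorD(1)[OF ae_operator_patch_op[OF B T]])
    qed
  qed (use B T T' in \<open>auto intro!: ae_operator_patch_op\<close>)
qed

text \<open>
  Let \<open>\<tau>\<close> carry Lebesgue measure to the density \<open>\<parallel>f\<parallel>\<^sup>p\<close>.  Composition with \<open>\<tau>\<close> becomes isometric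
  after multiplication by \<open>(1 / \<parallel>f \<circ> \<tau>\<parallel>\<^sup>p)\<^sup>1\<^sup>/\<^sup>p\<close>, and this weight is just what normalizes \<open>f \<circ> \<tau>\<close>.
\<close>

lemma isometric_to_unimodular:
  fixes f :: "real \<Rightarrow> 'a::real_normed_vector"
  assumes p: "1 \<le> p" and f: "simple_function unit_leb f" "\<And>t. f t \<noteq> 0" and N: "Lp_norm p (abs_L0 f) = 1"
  obtains T h where "isometric_automorphism (Lp_space p) (Lp_norm p) T" "T (abs_L0 f) = abs_L0 h"
    "simple_function unit_leb h" "\<forall>t. norm (h t) = 1"
proof -
  define g where "g t = norm (f t) powr p" for t
  have sm: "sm f" using f(1) by (rule strongly_measurable_simple)
  note [measurable] = strongly_measurable_norm[OF sm]
  have g: "g \<in> borel_measurable unit_leb" unfolding g_def by measurable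
  have g_pos: "0 < g t" for t using f(2) by (simp add: g_def)
  have "enn2real (Lp_nn_integral p (abs_L0 f)) = 1"
  proof -
    have "enn2real (Lp_nn_integral p (abs_L0 f)) = Lp_norm p (abs_L0 f) powr p"
      using p by (simp add: Lp_norm_def powr_powr)
    then show ?thesis using N by simp
  qed
  then have "Lp_nn_integral p (abs_L0 f) = 1"
    by (cases "Lp_nn_integral p (abs_L0 f)") auto
  then have g_int: "(\<integral>\<^sup>+t. ennreal (g t) \<partial>unit_leb) = 1"
    using sm by (simp add: Lp_nn_integral_abs g_def)
  have "AE t in unit_leb. 0 < g t" using g_pos by simp
  from rearrangement_exists[OF g this g_int, of "\<lambda>t. t" "\<lambda>t. t"]
  obtain \<tau> \<sigma> where r: "rearrangement \<tau> \<sigma> (\<lambda>u. 1 / g (\<tau> u))"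
    by (metis measurable_ident_sets)
  have [measurable]: "\<tau> \<in> unit_leb \<rightarrow>\<^sub>M unit_leb" by (rule rearrangementD(1)[OF r])
  define v where "v u = 1 / norm (f (\<tau> u))" for u
  have v: "v \<in> borel_measurable unit_leb" unfolding v_def by measurable
  have v0: "AE u in unit_leb. v u \<noteq> 0" using f(2) by (simp add: v_def)
  have op: "ae_operator (compose_op v \<tau>)" using r v by (rule ae_operator_compose_op)
  have "isometric_automorphism (Lp_space p) (Lp_norm p) (lift_op (compose_op v \<tau> :: (real \<Rightarrow> 'a) \<Rightarrow> _))"
  proof (rule isometric_automorphism_Lp[where \<Psi> = "compose_op (\<lambda>t. 1 / v (\<sigma> t)) \<sigma>"])
    have [measurable]: "\<sigma> \<in> unit_leb \<rightarrow>\<^sub>M unit_leb" by (rule rearrangementD(2)[OF r])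
    note [measurable] = v
    show "ae_operator (compose_op (\<lambda>t. 1 / v (\<sigma> t)) \<sigma>)"
      by (rule ae_operator_compose_op[OF rearrangement_inverse[OF r]]) measurable
    show "Lp_nn_integral p (abs_L0 (compose_op v \<tau> k)) = Lp_nn_integral p (abs_L0 k)"
      if k: "sm k" for k :: "real \<Rightarrow> 'a"
    proof -
      note [measurable] = strongly_measurable_norm[OF k]
      have "norm (compose_op v \<tau> k t) powr p = 1 / g (\<tau> t) * norm (k (\<tau> t)) powr p" for t
        by (simp add: compose_op_def v_def g_def powr_divide)
      then have "Lp_nn_integral p (abs_L0 (compose_op v \<tau> k)) =
          (\<integral>\<^sup>+t. ennreal (1 / g (\<tau> t)) * ennreal (norm (k (\<tau> t)) powr p) \<partial>unit_leb)"
        using k g_pos by (simp add: Lp_nn_integral_abs ae_operatorD(1)[OF op] less_imp_le flip: ennreal_mult)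
      also have "\<dots> = Lp_nn_integral p (abs_L0 k)"
        using k by (subst rearrangementD(7)[OF r, of "\<lambda>t. ennreal (norm (k t) powr p)"])
          (simp_all add: Lp_nn_integral_abs)
      finally show ?thesis .
    qed
  qed (use op compose_op_inverse[OF r v0] in auto)
  moreover have "lift_op (compose_op v \<tau>) (abs_L0 f) = abs_L0 (compose_op v \<tau> f)"
    using op sm by (rule lift_op_abs)
  moreover have "simple_function unit_leb (compose_op v \<tau> f)"
    unfolding compose_op_def[abs_def] v_def
    using simple_function_comp[OF rearrangementD(1)[OF r] f(1)] by (rule simple_function_compose1)
  moreover have "\<forall>t. norm (compose_op v \<tau> f t) = 1"
    using f(2) by (simp add: compose_op_def v_def)
  ultimately show ?thesis by (rule that)
qed

text \<open>
  Simple functions that converge to \<open>f\<close> almost everywhere are cut off where they exceed \<open>2 \<parallel>f\<parallel>\<close>, so that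
  dominated convergence applies.  Where they are cut off or vanish, a small multiple of \<open>z\<close> is
  substituted; it tends to zero and keeps the functions nonvanishing.
\<close>

lemma nonvanishing_simple_dense:
  fixes f :: "real \<Rightarrow> 'a::real_normed_vector"
  assumes p: "1 \<le> p" and f: "sm f" "abs_L0 f \<in> Lp_space p" and z: "norm (z :: 'a) = 1" and e: "0 < e"
  obtains h where "simple_function unit_leb h" "\<And>t. h t \<noteq> 0" "Lp_norm p (abs_L0 h - abs_L0 f) < e"
proof -
  obtain s where s: "\<And>i. simple_function unit_leb (s i)"
    "AE t in unit_leb. (\<lambda>i::nat. s i t) \<longlonglongrightarrow> f t"
    using f(1) unfolding strongly_measurable_def by blast
  note sms = strongly_measurable_simple[OF s(1)]
  note [measurable] = strongly_measurable_norm[OF f(1)] strongly_measurable_norm[OF sms]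
  define h where "h i t = (if 0 < norm (s i t) \<and> norm (s i t) \<le> 2 * norm (f t) then s i t
    else (1 / real (Suc i)) *\<^sub>R z)" for i t
  have h: "simple_function unit_leb (h i)" for i
    unfolding h_def by (intro simple_function_If s(1) simple_function_const) measurable
  have h0: "h i t \<noteq> 0" for i t using z by (auto simp: h_def)
  have smh: "sm (\<lambda>t. h i t - f t)" for i
    by (intro sm_diff f strongly_measurable_simple[OF h])
  note [measurable] = strongly_measurable_norm[OF smh]
  have z_lim: "(\<lambda>i. (1 / real (Suc i)) *\<^sub>R z) \<longlonglongrightarrow> 0"
    using tendsto_scaleR[OF LIMSEQ_inverse_real_of_nat tendsto_const, of z] by (simp add: inverse_eq_divide)
  have lim: "AE t in unit_leb. (\<lambda>i. h i t) \<longlonglongrightarrow> f t"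
    using s(2)
  proof eventually_elim
    case (elim t)
    show ?case
    proof (cases "f t = 0")
      case True
      then have "(\<lambda>i. h i t) = (\<lambda>i. (1 / real (Suc i)) *\<^sub>R z)" by (auto simp: h_def)
      then show ?thesis using z_lim True by simp
    next
      case False
      have "(\<lambda>i. norm (s i t)) \<longlonglongrightarrow> norm (f t)" using elim by (rule tendsto_norm)
      moreover have "0 < norm (f t)" "norm (f t) < 2 * norm (f t)" using False by auto
      ultimately have "\<forall>\<^sub>F i in sequentially. 0 < norm (s i t)"
        "\<forall>\<^sub>F i in sequentially. norm (s i t) < 2 * norm (f t)" by (blast dest: order_tendstoD)+
      then have "\<forall>\<^sub>F i in sequentially. s i t = h i t"
        by eventually_elim (simp add: h_def)
      then show ?thesis using elim by (rule Lim_transform_eventually[rotated])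
    qed
  qed
  \<comment> \<open>From \<open>\<parallel>h - f\<parallel> \<le> 3 \<parallel>f\<parallel> + 1 \<le> 4 max \<parallel>f\<parallel> 1\<close>.\<close>
  have bound: "norm (h i t - f t) powr p \<le> 4 powr p * (norm (f t) powr p + 1)" for i t
  proof -
    have z_le: "norm ((1 / real (Suc i)) *\<^sub>R z) \<le> 1" using z by simp
    have "norm (h i t) \<le> 2 * norm (f t) + 1"
    proof (cases "0 < norm (s i t) \<and> norm (s i t) \<le> 2 * norm (f t)")
      case False
      then have "h i t = (1 / real (Suc i)) *\<^sub>R z" unfolding h_def by (rule if_not_P)
      then have "norm (h i t) \<le> 1" using z_le by (simp only:)
      also have "1 \<le> 2 * norm (f t) + 1" by simp
      finally show ?thesis .
    qed (simp add: h_def)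
    then have "norm (h i t - f t) \<le> 3 * norm (f t) + 1"
      using norm_triangle_ineq4[of "h i t" "f t"] by simp
    also have "\<dots> \<le> 4 * max (norm (f t)) 1" by simp
    finally have "norm (h i t - f t) powr p \<le> (4 * max (norm (f t)) 1) powr p"
      using p by (intro powr_mono2) auto
    also have "\<dots> = 4 powr p * max (norm (f t)) 1 powr p" by (simp add: powr_mult)
    also have "max (norm (f t)) 1 powr p \<le> norm (f t) powr p + 1" by (simp add: max_def)
    finally show ?thesis by simp
  qed
  have "(\<lambda>i. \<integral>\<^sup>+t. ennreal (norm (h i t - f t) powr p) \<partial>unit_leb) \<longlonglongrightarrow> (\<integral>\<^sup>+t. 0 \<partial>unit_leb)"
  proof (rule nn_integral_dominated_convergence[where w = "\<lambda>t. ennreal (4 powr p * (norm (f t) powr p + 1))"])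
    show "AE t in unit_leb. ennreal (norm (h i t - f t) powr p) \<le> ennreal (4 powr p * (norm (f t) powr p + 1))" for i
      using bound by (intro AE_I2 ennreal_leI)
    have "(\<integral>\<^sup>+t. ennreal (4 powr p * (norm (f t) powr p + 1)) \<partial>unit_leb) =
        ennreal (4 powr p) * (Lp_nn_integral p (abs_L0 f) + 1)"
      using f(1) unit_leb_not_null
      by (simp add: ennreal_mult nn_integral_cmult nn_integral_add Lp_nn_integral_abs)
    also have "\<dots> < \<infinity>" using f(2) by (simp add: Lp_space_def ennreal_mult_less_top)
    finally show "(\<integral>\<^sup>+t. ennreal (4 powr p * (norm (f t) powr p + 1)) \<partial>unit_leb) < \<infinity>" .
    show "AE t in unit_leb. (\<lambda>i. ennreal (norm (h i t - f t) powr p)) \<longlonglongrightarrow> 0"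
      using lim
    proof eventually_elim
      case (elim t)
      then have "(\<lambda>i. norm (h i t - f t)) \<longlonglongrightarrow> 0" by (simp add: tendsto_norm_zero LIM_zero)
      then have "(\<lambda>i. norm (h i t - f t) powr p) \<longlonglongrightarrow> 0 powr p"
        using p by (intro tendsto_powr') auto
      then show ?case using p tendsto_ennrealI by fastforce
    qed
  qed measurable
  then have "(\<lambda>i. Lp_nn_integral p (abs_L0 (\<lambda>t. h i t - f t))) \<longlonglongrightarrow> 0"
    using smh by (simp add: Lp_nn_integral_abs)
  moreover have "0 < ennreal ((e / 2) powr p)" using e by simp
  ultimately have "\<forall>\<^sub>F i in sequentially. Lp_nn_integral p (abs_L0 (\<lambda>t. h i t - f t)) < ennreal ((e / 2) powr p)"
    by (rule order_tendstoD)
  then obtain i where "Lp_nn_integral p (abs_L0 (\<lambda>t. h i t - f t)) < ennreal ((e / 2) powr p)"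
    by (auto dest: eventually_happens)
  then have "Lp_norm p (abs_L0 (\<lambda>t. h i t - f t)) \<le> e / 2"
    using e by (intro Lp_normI(2) p) auto
  then have "Lp_norm p (abs_L0 (h i) - abs_L0 f) < e"
    using e f(1) strongly_measurable_simple[OF h] by (simp add: abs_L0_diff)
  with h h0 show ?thesis by (rule that)
qed

lemma convex_transitive_Lp:
  assumes X: "convex_transitive (UNIV :: 'a::real_normed_vector set) norm" and p: "1 \<le> p"
  shows "convex_transitive (Lp_space p :: 'a L0 set) (Lp_norm p)"
proof -
  interpret Lp: L0_function_space "Lp_space p :: 'a L0 set" "Lp_norm p"
    using p by (rule L0_function_space_Lp)
  let ?D = "{abs_L0 f | f :: real \<Rightarrow> 'a. simple_function unit_leb f \<and> (\<forall>t. f t \<noteq> 0)}"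
  show ?thesis
  proof (rule Lp.convex_transitiveI)
    show D: "?D \<subseteq> Lp_space p" using Lp.simple_mem by blast
    show "c *\<^sub>R F \<in> ?D" if F: "F \<in> ?D" "c \<noteq> 0" for F c
    proof -
      obtain f where f: "F = abs_L0 f" "simple_function unit_leb f" "\<And>t. f t \<noteq> 0" using F by blast
      then have "c *\<^sub>R F = abs_L0 (\<lambda>t. c *\<^sub>R f t)" by (simp add: abs_L0_scale strongly_measurable_simple)
      moreover have "simple_function unit_leb (\<lambda>t. c *\<^sub>R f t)" "\<And>t. c *\<^sub>R f t \<noteq> 0"
        using simple_function_compose1[OF f(2)] f(3) F(2) by auto
      ultimately show ?thesis by blast
    qed
    show "\<exists>G\<in>?D. Lp_norm p (G - F) < e" if F: "F \<in> Lp_space p" "Lp_norm p F = 1" "0 < e" for F e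
    proof -
      obtain f where f: "sm f" "F = abs_L0 f" by (rule L0_cases)
      have "\<exists>x :: 'a. x \<noteq> 0"
      proof (rule ccontr)
        assume "\<not> ?thesis"
        then have "F = abs_L0 (\<lambda>t. 0)" using f by (simp add: abs_L0_eq_iff strongly_measurable_simple)
        then show False using F(2) Lp.N_zero by (simp add: zero_L0_def)
      qed
      then obtain x :: 'a where "x \<noteq> 0" by blast
      then have "norm (sgn x) = 1" by (simp add: norm_sgn)
      with nonvanishing_simple_dense[OF p f(1) _ _ F(3)] F(1) f(2) obtain h where
        "simple_function unit_leb h" "\<And>t. h t \<noteq> 0" "Lp_norm p (abs_L0 h - F) < e" by metis
      then show ?thesis by blast
    qed
    show "G \<in> Lp.orbit_hull F"
      if FG: "F \<in> ?D" "G \<in> ?D" "Lp_norm p F = 1" "Lp_norm p G = 1" for F G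
    proof -
      have FV: "F \<in> Lp_space p" "G \<in> Lp_space p" using FG D by auto
      obtain f' where f': "F = abs_L0 f'" "simple_function unit_leb f'" "\<And>t. f' t \<noteq> 0"
        using FG(1) by blast
      obtain T f where f: "isometric_automorphism (Lp_space p) (Lp_norm p) T" "T (abs_L0 f') = abs_L0 f"
        "simple_function unit_leb f" "\<forall>t. norm (f t) = 1"
        by (rule isometric_to_unimodular[OF p f'(2,3) FG(3)[unfolded f'(1)]])
      obtain g' where g': "G = abs_L0 g'" "simple_function unit_leb g'" "\<And>t. g' t \<noteq> 0"
        using FG(2) by blast
      obtain S g where g: "isometric_automorphism (Lp_space p) (Lp_norm p) S" "S (abs_L0 g') = abs_L0 g"
        "simple_function unit_leb g" "\<forall>t. norm (g t) = 1"
        by (rule isometric_to_unimodular[OF p g'(2,3) FG(4)[unfolded g'(1)]])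
      have "abs_L0 f \<in> Lp.orbit_hull F"
        using Lp.orbit_hull_invariant[OF FV(1) f(1) Lp.self_in_orbit_hull[OF FV(1)]] f(2) f'(1) by simp
      then have "S G \<in> Lp.orbit_hull F"
        unfolding g'(1) g(2)
        by (rule Lp.unimodular_in_orbit_hull[OF X FV(1) f(3) _ _ g(3)]) (use f g in simp_all)
      then have "inv_into (Lp_space p) S (S G) \<in> Lp.orbit_hull F"
        by (rule Lp.orbit_hull_invariant[OF FV(1) Lp.isometric_automorphism_inverse[OF g(1)]])
      also have "inv_into (Lp_space p) S (S G) = G"
        using g(1) FV(2) unfolding isometric_automorphism_def by (blast intro: bij_betw_inv_into_left)
      finally show ?thesis .
    qed
  qed
qed

section \<open>Convex-transitivity of both kinds of spaces\<close>

theorem theorem2p1: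
  assumes "convex_transitive (UNIV :: 'a::banach set) norm"
  shows "convex_transitive (Linf_simple_space :: 'a L0 set) Linf_norm \<and>
         (\<forall>p::real. 1 \<le> p \<longrightarrow> convex_transitive (Lp_space p :: 'a L0 set) (Lp_norm p))"
  using convex_transitive_Linf_simple[OF assms] convex_transitive_Lp[OF assms] by blast

end
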